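(* Let $n\ge4$. Let $I_n$ be the ideal of all $f\in\mathbb C[x_1,\dots,x_n]^{\mathfrak S_n}$ such that $f(x,x,y,y,x_5,\dots,x_n)=0$ identically, and let $I_{n,d}$ be its homogeneous component of degree $d$. Then $$\operatorname{ch} I_n:=\sum_{d=0}^\infty(\dim_{\mathbb C} I_{n,d})\,q^d=\frac{q^{(n-1)(n-3)}}{(q)_1(q)_{n-3}}+\frac{q^{(n-2)(n-1)}}{(q)_1(q)_{n-2}}+\frac{q^{n(n-1)}}{(q)_n}.$$
   Context: $(q)_s=\prod_{j=1}^s(1-q^j)$. The grading is by total degree in $x_1,\dots,x_n$ (each $x_i$ has degree 1). The identity is one of formal power series in $q$. *)

theory Defs
  imports
    Complex_Main
    "HOL-Library.Poly_Mapping"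
    "HOL-Combinatorics.Permutations"
    "HOL-Computational_Algebra.Formal_Power_Series"
begin

text \<open>
  Polynomials over the complex numbers in countably many indeterminates: finitely supported
  coefficient functions on monomials, a monomial being a finitely supported exponent function.
  The ring structure is the convolution product of Poly_Mapping.
\<close>

type_synonym monom = "nat \<Rightarrow>\<^sub>0 nat"
type_synonym cpoly = "monom \<Rightarrow>\<^sub>0 complex"

definition const :: "complex \<Rightarrow> cpoly" where
  "const c = Poly_Mapping.single 0 c"

definition X :: "nat \<Rightarrow> cpoly" where
  "X i = Poly_Mapping.single (Poly_Mapping.single i 1) 1"

definition scale :: "complex \<Rightarrow> cpoly \<Rightarrow> cpoly" where
  "scale c f = const c * f"

global_interpretation cpoly: vector_space scale
proof
  show "scale a (x + y) = scale a x + scale a y" for a x y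
    by (simp add: scale_def distrib_left)
  show "scale (a + b) x = scale a x + scale b x" for a b x
    by (simp add: scale_def const_def single_add distrib_right)
  show "scale a (scale b x) = scale (a * b) x" for a b x
    by (simp add: scale_def const_def mult_single flip: mult.assoc)
  show "scale 1 x = x" for x
    by (simp add: scale_def const_def)
qed

definition total_degree :: "monom \<Rightarrow> nat" where
  "total_degree m = (\<Sum>i\<in>Poly_Mapping.keys m. Poly_Mapping.lookup m i)"

definition homogeneous :: "nat \<Rightarrow> cpoly \<Rightarrow> bool" where
  "homogeneous d f \<longleftrightarrow> (\<forall>m\<in>Poly_Mapping.keys f. total_degree m = d)"

definition polys :: "nat \<Rightarrow> cpoly set" where
  "polys n = {f. \<forall>m\<in>Poly_Mapping.keys f. Poly_Mapping.keys m \<subseteq> {1..n}}"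

text \<open>The polynomial \<open>f(s 1, s 2, \<dots>)\<close>.\<close>

definition subst :: "(nat \<Rightarrow> cpoly) \<Rightarrow> cpoly \<Rightarrow> cpoly" where
  "subst s f = (\<Sum>m\<in>Poly_Mapping.keys f. const (Poly_Mapping.lookup f m) * (\<Prod>i\<in>Poly_Mapping.keys m. s i ^ Poly_Mapping.lookup m i))"

definition sym_polys :: "nat \<Rightarrow> cpoly set" where
  "sym_polys n = {f \<in> polys n. \<forall>\<sigma>. \<sigma> permutes {1..n} \<longrightarrow> subst (\<lambda>i. X (\<sigma> i)) f = f}"

text \<open>
  In \<open>f(x,x,y,y,x\<^sub>5,\<dots>,x\<^sub>n)\<close> the indeterminates \<open>x\<close> and \<open>y\<close> are taken to be \<open>X 1\<close> and \<open>X 3\<close>,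
  and vanishing identically is equality with the zero polynomial.
\<close>

definition pairs_collapsed :: "nat \<Rightarrow> cpoly" where
  "pairs_collapsed i = (if i = 2 then X 1 else if i = 4 then X 3 else X i)"

definition ideal_I :: "nat \<Rightarrow> cpoly set" where
  "ideal_I n = {f \<in> sym_polys n. subst pairs_collapsed f = 0}"

definition ideal_I_comp :: "nat \<Rightarrow> nat \<Rightarrow> cpoly set" where
  "ideal_I_comp n d = {f \<in> ideal_I n. homogeneous d f}"

text \<open>
  The dimension is an honest finite one: only finitely many monomials in \<open>X 1, \<dots>, X n\<close> have
  total degree \<open>d\<close>.
\<close>

definition ch_I :: "nat \<Rightarrow> rat fps" where
  "ch_I n = Abs_fps (\<lambda>d. of_nat (cpoly.dim (ideal_I_comp n d)))"

definition qfac :: "nat \<Rightarrow> rat fps" where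
  "qfac s = (\<Prod>j = 1..s. 1 - fps_X ^ j)"

end

theory Submission
  imports Defs
begin

text \<open>
  Write \<open>\<phi>\<^sub>m f = f(x,\<dots>,x,x\<^sub>m\<^sub>+\<^sub>1,\<dots>,x\<^sub>n)\<close> with \<open>x\<close> repeated \<open>m\<close> times, and filter \<open>I\<^sub>n\<close> by
  \<open>I\<^sub>n \<supseteq> K = I\<^sub>n \<inter> ker \<phi>\<^sub>3 \<supseteq> J = ker \<phi>\<^sub>2\<close>. For \<open>f \<in> I\<^sub>n\<close> (if \<open>m = 3\<close>) or \<open>f \<in> K\<close> (if \<open>m = 2\<close>), the polynomial
  \<open>\<phi>\<^sub>m f\<close> vanishes on \<open>x\<^sub>i = x\<^sub>j\<close> for \<open>i, j > m\<close>, hence to order \<open>2\<close> by symmetry, and it vanishes on \<open>x = x\<^sub>l\<close>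
  to order \<open>m\<close>. So it is a multiple of \<open>D\<^sub>m = \<Prod>\<^sub>l (x - x\<^sub>l)\<^sup>m \<Prod>\<^sub>i\<^sub><\<^sub>j (x\<^sub>i - x\<^sub>j)\<^sup>2\<close>, and conversely, for \<open>a\<close> symmetric
  in \<open>x\<^sub>m\<^sub>+\<^sub>1,\<dots>,x\<^sub>n\<close>, the product \<open>D\<^sub>m a\<close> is the image of a symmetrisation over \<open>S\<^sub>n\<close>. Likewise \<open>J\<close> consists
  of the symmetric multiples of the discriminant. The three graded pieces, shifted by \<open>deg D\<^sub>3\<close>,
  \<open>deg D\<^sub>2\<close> and \<open>n(n - 1)\<close>, give the three summands.
\<close>

text \<open>As a destruction rule this loops against \<open>in_keys_iff\<close>.\<close>
declare lookup_eq_zero_in_keys_contradict [rule del]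

abbreviation lkp where "lkp \<equiv> Poly_Mapping.lookup"
abbreviation kys where "kys \<equiv> Poly_Mapping.keys"

subsection \<open>Substitution, variables and degree\<close>

lemma const_0 [simp]: "const 0 = 0" by (simp add: const_def)
lemma const_1 [simp]: "const 1 = 1" by (simp add: const_def)
lemma const_add: "const (a + b) = const a + const b" by (simp add: const_def single_add)
lemma const_mult: "const (a * b) = const a * const b" by (simp add: const_def mult_single)
lemma const_power: "const (a ^ k) = const a ^ k" by (induction k) (auto simp: const_mult)
lemma const_numeral [simp]: "const (numeral k) = numeral k" by (simp add: const_def)
lemma const_of_nat: "const (of_nat k) = of_nat k" by (simp add: const_def)
lemma const_eq_0_iff [simp]: "const c = 0 \<longleftrightarrow> c = 0"
  by (metis const_def keys_single keys_zero insert_not_empty single_zero)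

lemma lookup_const_mult: "lkp (const c * f) m = c * lkp f m"
  by (simp add: const_def map.rep_eq when_def flip: mult_map_scale_conv_mult)

section \<open>Substitution as a ring homomorphism\<close>

definition mon :: "(nat \<Rightarrow> cpoly) \<Rightarrow> monom \<Rightarrow> cpoly" where
  "mon s m = (\<Prod>i\<in>kys m. s i ^ lkp m i)"

lemma mon_superset:
  assumes "finite K" "kys m \<subseteq> K"
  shows "mon s m = (\<Prod>i\<in>K. s i ^ lkp m i)"
  unfolding mon_def by (rule prod.mono_neutral_left) (use assms in \<open>auto simp: in_keys_iff\<close>)

lemma mon_0 [simp]: "mon s 0 = 1" by (simp add: mon_def)

lemma mon_add: "mon s (m + m') = mon s m * mon s m'"
proof -
  let ?K = "kys m \<union> kys m'"
  have "mon s (m + m') = (\<Prod>i\<in>?K. s i ^ lkp (m + m') i)"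
    by (rule mon_superset) (use keys_add[of m m'] in auto)
  also have "\<dots> = (\<Prod>i\<in>?K. s i ^ lkp m i) * (\<Prod>i\<in>?K. s i ^ lkp m' i)"
    by (simp add: lookup_add power_add prod.distrib)
  also have "\<dots> = mon s m * mon s m'" by (simp add: mon_superset[of ?K])
  finally show ?thesis .
qed

text \<open>Summing over any finite set containing the support puts polynomials with different
  supports on a common index set; additivity of \<open>subst\<close> rests on this.\<close>

lemma subst_superset:
  assumes "finite K" "kys f \<subseteq> K"
  shows "subst s f = (\<Sum>m\<in>K. const (lkp f m) * mon s m)"
  unfolding subst_def mon_def[symmetric]
  by (rule sum.mono_neutral_left) (use assms in \<open>auto simp: in_keys_iff\<close>)

lemma subst_0 [simp]: "subst s 0 = 0" by (simp add: subst_def)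

lemma subst_add [simp]: "subst s (f + g) = subst s f + subst s g"
proof -
  let ?K = "kys f \<union> kys g"
  have "subst s (f + g) = (\<Sum>m\<in>?K. const (lkp (f + g) m) * mon s m)"
    by (rule subst_superset) (use keys_add[of f g] in auto)
  also have "\<dots> = (\<Sum>m\<in>?K. const (lkp f m) * mon s m) + (\<Sum>m\<in>?K. const (lkp g m) * mon s m)"
    by (simp add: lookup_add const_add ring_distribs sum.distrib)
  also have "\<dots> = subst s f + subst s g" by (simp add: subst_superset[of ?K])
  finally show ?thesis .
qed

lemma subst_single: "subst s (Poly_Mapping.single m c) = const c * mon s m"
  by (subst subst_superset[of "{m}"]) auto

text \<open>A finitely supported function is built by setting fresh coefficients one at a time, and
  setting a fresh coefficient is the same as adding a \<open>single\<close>.\<close>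

lemma cpoly_induct_single [case_names single add]:
  assumes "\<And>m c. P (Poly_Mapping.single m c)" "\<And>f g. P f \<Longrightarrow> P g \<Longrightarrow> P (f + g)"
  shows "P (f :: cpoly)"
proof (induction f rule: Poly_Mapping.update_induct)
  case const
  then show ?case using assms(1)[of 0 0] by simp
next
  case (update f a b)
  have "Poly_Mapping.update a b f = Poly_Mapping.single a b + f"
  proof (rule poly_mapping_eqI)
    fix k
    show "lkp (Poly_Mapping.update a b f) k = lkp (Poly_Mapping.single a b + f) k"
      using update(1) by (cases "a = k") (auto simp: lookup_update lookup_add lookup_single in_keys_iff)
  qed
  then show ?case using assms update by simp
qed

lemma subst_mult [simp]: "subst s (f * g) = subst s f * subst s g"
proof (induction f rule: cpoly_induct_single)
  case (single m c)
  show ?case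
    by (induction g rule: cpoly_induct_single)
      (auto simp: mult_single subst_single mon_add const_mult algebra_simps)
qed (auto simp: ring_distribs)

lemma subst_const [simp]: "subst s (const c) = const c"
  by (simp add: const_def subst_single)

lemma subst_1 [simp]: "subst s 1 = 1"
  using subst_const[of s 1] by (simp del: subst_const)

lemma subst_numeral [simp]: "subst s (numeral k) = numeral k"
  using subst_const[of s "numeral k"] by (simp del: subst_const)

lemma subst_of_nat [simp]: "subst s (of_nat k) = of_nat k"
  using subst_const[of s "of_nat k"] by (simp add: const_of_nat del: subst_const)

lemma subst_X [simp]: "subst s (X i) = s i"
  unfolding X_def by (subst subst_single) (auto simp: mon_def)

lemma subst_uminus [simp]: "subst s (- f) = - subst s f"
  using subst_add[of s f "- f"] by (simp add: eq_neg_iff_add_eq_0 add.commute del: subst_add)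

lemma subst_diff [simp]: "subst s (f - g) = subst s f - subst s g"
  using subst_add[of s f "- g"] by (simp del: subst_add)

lemma subst_power [simp]: "subst s (f ^ k) = subst s f ^ k"
  by (induction k) auto

lemma subst_sum [simp]: "subst s (sum f A) = (\<Sum>x\<in>A. subst s (f x))"
  by (induction A rule: infinite_finite_induct) auto

lemma subst_prod [simp]: "subst s (prod f A) = (\<Prod>x\<in>A. subst s (f x))"
  by (induction A rule: infinite_finite_induct) auto

lemma X_power: "X i ^ k = Poly_Mapping.single (Poly_Mapping.single i k) 1"
proof (induction k)
  case (Suc k)
  then show ?case by (simp add: X_def mult_single single_add[symmetric])
qed auto

lemma single_eq_mon: "Poly_Mapping.single m c = const c * mon X m"
proof -
  have *: "(\<Prod>i\<in>K. X i ^ lkp m i) = Poly_Mapping.single (\<Sum>i\<in>K. Poly_Mapping.single i (lkp m i)) 1"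
    if "finite K" for K
    using that by (induction K rule: finite_induct) (auto simp: X_power mult_single)
  have "m = (\<Sum>i\<in>kys m. Poly_Mapping.single i (lkp m i))"
    by (intro poly_mapping_eqI) (auto simp: lookup_sum lookup_single when_def in_keys_iff)
  then have "mon X m = Poly_Mapping.single m 1"
    using *[of "kys m"] by (simp add: mon_def)
  then show ?thesis by (simp add: const_def mult_single)
qed

text \<open>Constants and variables generate the polynomial ring, so identities between
  substitutions, and congruences, need checking only there.\<close>

lemma cpoly_induct [case_names const X add mult]:
  assumes "\<And>c. P (const c)" "\<And>i. P (X i)" "\<And>f g. P f \<Longrightarrow> P g \<Longrightarrow> P (f + g)"
    "\<And>f g. P f \<Longrightarrow> P g \<Longrightarrow> P (f * g)"
  shows "P f"
proof (induction f rule: cpoly_induct_single)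
  case (single m c)
  have pow: "P (X i ^ k)" for i k
    by (induction k) (use assms(1)[of 1] assms(2,4) in auto)
  have "P (\<Prod>i\<in>K. X i ^ lkp m i)" if "finite K" for K
    using that by (induction K rule: finite_induct) (use assms(1)[of 1] assms(4) pow in auto)
  then show ?case using assms(1,4) by (simp add: single_eq_mon mon_def)
qed (fact assms(3))

lemma subst_subst: "subst s (subst t f) = subst (\<lambda>i. subst s (t i)) f"
  by (induction f rule: cpoly_induct) auto

lemma subst_ident [simp]: "subst X f = f"
  by (induction f rule: cpoly_induct) auto

section \<open>Polynomials in a prescribed set of variables\<close>

definition Pol :: "nat set \<Rightarrow> cpoly set" where
  "Pol V = {f. \<forall>m\<in>kys f. kys m \<subseteq> V}"

lemma polys_eq_Pol: "polys n = Pol {1..n}" by (simp add: polys_def Pol_def)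

lemma Pol_const [simp]: "const c \<in> Pol V" by (auto simp: Pol_def const_def)
lemma Pol_X: "i \<in> V \<Longrightarrow> X i \<in> Pol V" by (auto simp: Pol_def X_def)
lemma Pol_add: "f \<in> Pol V \<Longrightarrow> g \<in> Pol V \<Longrightarrow> f + g \<in> Pol V"
  using keys_add[of f g] unfolding Pol_def by blast
lemma Pol_mult:
  assumes "f \<in> Pol V" "g \<in> Pol V"
  shows "f * g \<in> Pol V"
  unfolding Pol_def
proof (intro CollectI ballI)
  fix m assume "m \<in> kys (f * g)"
  then obtain a b where "m = a + b" "a \<in> kys f" "b \<in> kys g" using keys_mult[of f g] by blast
  then show "kys m \<subseteq> V" using keys_add[of a b] assms unfolding Pol_def by blast
qed
lemma Pol_0 [simp]: "0 \<in> Pol V" by (simp add: Pol_def)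
lemma Pol_1 [simp]: "1 \<in> Pol V" using Pol_const[of 1 V] by simp
lemma Pol_uminus: "f \<in> Pol V \<Longrightarrow> - f \<in> Pol V"
  by (simp add: Pol_def in_keys_iff)
lemma Pol_diff: "f \<in> Pol V \<Longrightarrow> g \<in> Pol V \<Longrightarrow> f - g \<in> Pol V"
  using Pol_add[of f V "- g"] Pol_uminus by simp
lemma Pol_power: "f \<in> Pol V \<Longrightarrow> f ^ k \<in> Pol V"
  by (induction k) (auto intro: Pol_mult)
lemma Pol_sum: "(\<And>x. x \<in> A \<Longrightarrow> f x \<in> Pol V) \<Longrightarrow> sum f A \<in> Pol V"
  by (induction A rule: infinite_finite_induct) (auto intro: Pol_add)
lemma Pol_prod: "(\<And>x. x \<in> A \<Longrightarrow> f x \<in> Pol V) \<Longrightarrow> prod f A \<in> Pol V"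
  by (induction A rule: infinite_finite_induct) (auto intro: Pol_mult)
lemma Pol_mono: "f \<in> Pol V \<Longrightarrow> V \<subseteq> W \<Longrightarrow> f \<in> Pol W" by (auto simp: Pol_def)

lemma Pol_subst:
  assumes "f \<in> Pol V" "\<And>i. i \<in> V \<Longrightarrow> s i \<in> Pol W"
  shows "subst s f \<in> Pol W"
  unfolding subst_def
proof (intro Pol_sum Pol_mult Pol_prod Pol_power Pol_const)
  fix m i assume "m \<in> kys f" "i \<in> kys m"
  then have "i \<in> V" using assms(1) by (auto simp: Pol_def)
  then show "s i \<in> Pol W" by (rule assms(2))
qed

lemma subst_cong:
  assumes "f \<in> Pol V" "\<And>i. i \<in> V \<Longrightarrow> s i = t i"
  shows "subst s f = subst t f"
  unfolding subst_def
proof (intro sum.cong refl arg_cong2[of _ _ _ _ "(*)"] prod.cong)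
  fix m i assume "m \<in> kys f" "i \<in> kys m"
  then have "i \<in> V" using assms(1) by (auto simp: Pol_def)
  then show "s i ^ lkp m i = t i ^ lkp m i" by (simp add: assms(2))
qed

text \<open>Killing the variables outside \<open>V\<close> is a ring homomorphism that fixes
  \<open>g\<close> and \<open>g * h\<close>. Cancelling \<open>g\<close> shows that it fixes
  \<open>h\<close> as well.\<close>

lemma Pol_quotient:
  assumes "g * h \<in> Pol V" "g \<in> Pol V" "g \<noteq> 0"
  shows "h \<in> Pol V"
proof -
  let ?s = "\<lambda>i. if i \<in> V then X i else 0"
  have s: "subst ?s f = f" if "f \<in> Pol V" for f
    using subst_cong[OF that, of ?s X] by simp
  have "g * subst ?s h = g * h" using s[OF assms(1)] s[OF assms(2)] by simp
  then have "h = subst ?s h" using \<open>g \<noteq> 0\<close> by simp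
  also have "\<dots> \<in> Pol V"
    by (rule Pol_subst[of _ UNIV]) (auto simp: Pol_def X_def)
  finally show ?thesis .
qed

lemma X_inj [simp]: "X i = X j \<longleftrightarrow> i = j"
proof
  assume "X i = X j"
  then have "kys (X i) = kys (X j)" by simp
  then have "Poly_Mapping.single i (1::nat) = Poly_Mapping.single j 1" by (simp add: X_def)
  then have "kys (Poly_Mapping.single i (1::nat)) = kys (Poly_Mapping.single j (1::nat))" by simp
  then show "i = j" by simp
qed auto

text \<open>Homogeneity of degree \<open>d\<close> is detected by the single scaling \<open>X i \<mapsto> 2 X i\<close>.\<close>

lemma mon_scale: "mon (\<lambda>i. 2 * s i) m = 2 ^ total_degree m * mon s m"
  by (simp add: mon_def total_degree_def power_mult_distrib prod.distrib power_sum)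

lemma lookup_two_power_mult: "lkp (2 ^ d * f :: cpoly) m = 2 ^ d * lkp f m"
  using lookup_const_mult[of "2 ^ d" f m] by (simp add: const_power)

lemma lookup_subst_double: "lkp (subst (\<lambda>i. 2 * X i) f) m = 2 ^ total_degree m * lkp f m"
proof (induction f rule: cpoly_induct_single)
  case (single k c)
  have "subst (\<lambda>i. 2 * X i) (Poly_Mapping.single k c) = 2 ^ total_degree k * Poly_Mapping.single k c"
    by (simp only: subst_single mon_scale) (simp add: single_eq_mon[of k c] mult_ac)
  then show ?case by (simp add: lookup_two_power_mult lookup_single when_def)
qed (auto simp: lookup_add ring_distribs)

lemma two_power_inj: "(2::complex) ^ a = 2 ^ b \<longleftrightarrow> a = b"
proof
  assume "(2::complex) ^ a = 2 ^ b"
  then have "norm ((2::complex) ^ a) = norm ((2::complex) ^ b)" by simp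
  then show "a = b" by (simp add: norm_power)
qed simp

lemma homogeneous_iff: "homogeneous d f \<longleftrightarrow> subst (\<lambda>i. 2 * X i) f = 2 ^ d * f"
proof -
  have "(subst (\<lambda>i. 2 * X i) f = 2 ^ d * f) \<longleftrightarrow>
      (\<forall>m. 2 ^ total_degree m * lkp f m = 2 ^ d * lkp f m)"
    by (simp add: poly_mapping_eq_iff fun_eq_iff lookup_subst_double lookup_two_power_mult)
  also have "\<dots> \<longleftrightarrow> homogeneous d f"
    by (auto simp: in_keys_iff homogeneous_def two_power_inj)
  finally show ?thesis by simp
qed

lemma homogeneous_0 [simp]: "homogeneous d 0" by (simp add: homogeneous_def)

lemma homogeneous_1: "homogeneous 0 1" by (simp add: homogeneous_iff)

lemma homogeneous_const: "homogeneous 0 (const c)" by (simp add: homogeneous_iff)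

lemma homogeneous_X: "homogeneous 1 (X i)" by (simp add: homogeneous_iff)

lemma homogeneous_add: "homogeneous d f \<Longrightarrow> homogeneous d g \<Longrightarrow> homogeneous d (f + g)"
  by (simp add: homogeneous_iff ring_distribs)

lemma homogeneous_diff: "homogeneous d f \<Longrightarrow> homogeneous d g \<Longrightarrow> homogeneous d (f - g)"
  by (simp add: homogeneous_iff ring_distribs)

lemma homogeneous_sum: "(\<And>x. x \<in> A \<Longrightarrow> homogeneous d (f x)) \<Longrightarrow> homogeneous d (sum f A)"
  by (induction A rule: infinite_finite_induct) (auto intro: homogeneous_add)

lemma homogeneous_mult: "homogeneous d f \<Longrightarrow> homogeneous e g \<Longrightarrow> homogeneous (d + e) (f * g)"
  by (simp add: homogeneous_iff power_add const_mult algebra_simps)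

lemma homogeneous_const_mult: "homogeneous d f \<Longrightarrow> homogeneous d (const c * f)"
  using homogeneous_mult[OF homogeneous_const] by simp

lemma homogeneous_power: "homogeneous d f \<Longrightarrow> homogeneous (k * d) (f ^ k)"
proof (induction k)
  case (Suc k)
  then show ?case using homogeneous_mult[of d f "k * d" "f ^ k"] by simp
qed (simp add: homogeneous_1)

lemma homogeneous_prod:
  "(\<And>x. x \<in> A \<Longrightarrow> homogeneous (d x) (f x)) \<Longrightarrow> homogeneous (sum d A) (prod f A)"
  by (induction A rule: infinite_finite_induct) (auto intro: homogeneous_mult homogeneous_1)

lemma homogeneous_subst:
  assumes "homogeneous d f" "\<And>i. homogeneous 1 (s i)"
  shows "homogeneous d (subst s f)"
proof -
  have "subst (\<lambda>i. 2 * X i) (subst s f) = subst s (subst (\<lambda>i. 2 * X i) f)"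
    using assms(2) by (simp add: subst_subst homogeneous_iff)
  then show ?thesis using assms(1) by (simp add: homogeneous_iff)
qed

text \<open>Doubling all variables multiplies \<open>g\<close> and \<open>g * h\<close> by known
  powers of 2; cancelling \<open>2 ^ e * g\<close> leaves the scaling law for
  \<open>h\<close>.\<close>

lemma homogeneous_quotient:
  assumes "homogeneous (e + d) (g * h)" "homogeneous e g" "g \<noteq> 0"
  shows "homogeneous d h"
proof -
  have "(2 ^ e * g) * subst (\<lambda>i. 2 * X i) h = 2 ^ (e + d) * (g * h)"
    using assms(1,2) by (simp add: homogeneous_iff)
  also have "\<dots> = (2 ^ e * g) * (2 ^ d * h)" by (simp add: power_add mult_ac)
  finally have "subst (\<lambda>i. 2 * X i) h = 2 ^ d * h" using \<open>g \<noteq> 0\<close> by (simp only: mult_cancel_left) simp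
  then show ?thesis by (simp add: homogeneous_iff)
qed

text \<open>If the product were nonzero, then a monomial \<open>m\<close> of \<open>h\<close> would
  give \<open>d = e + total_degree m\<close> by comparing powers of 2. This settles all degrees
  below that of the divisor.\<close>

lemma homogeneous_mult_less_eq_0:
  assumes "homogeneous d (g * h)" "homogeneous e g" "d < e"
  shows "g * h = 0"
proof (rule ccontr)
  assume "g * h \<noteq> 0"
  then have g: "g \<noteq> 0" and "h \<noteq> 0" by auto
  then obtain m where m: "lkp h m \<noteq> 0" by (metis poly_mapping_eqI lookup_zero)
  have "g * (2 ^ e * subst (\<lambda>i. 2 * X i) h) = 2 ^ d * (g * h)"
    using assms(1,2) by (simp add: homogeneous_iff mult_ac)
  also have "\<dots> = g * (2 ^ d * h)" by (simp add: mult_ac)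
  finally have "2 ^ e * subst (\<lambda>i. 2 * X i) h = 2 ^ d * h" using g by (simp only: mult_cancel_left) simp
  then have "2 ^ d * lkp h m = 2 ^ e * (2 ^ total_degree m * lkp h m)"
    by (metis lookup_two_power_mult lookup_subst_double)
  then have "(2::complex) ^ d = 2 ^ (e + total_degree m)" using m by (simp add: power_add)
  then show False using \<open>d < e\<close> by (simp add: two_power_inj)
qed

section \<open>The factor theorem\<close>

text \<open>Modulo \<open>X j - p\<close> the variable \<open>X j\<close> is congruent to
  \<open>p\<close>, and congruences respect sums and products, so it suffices to look at the
  generators.\<close>

lemma X_minus_dvd_diff_subst: "X j - p dvd f - subst (X(j := p)) f"
proof (induction f rule: cpoly_induct)
  case (mult f g)
  have "f * g - subst (X(j := p)) (f * g) =
      f * (g - subst (X(j := p)) g) + (f - subst (X(j := p)) f) * subst (X(j := p)) g"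
    by (simp add: algebra_simps)
  then show ?case using mult by (metis dvd_add dvd_mult dvd_mult2)
next
  case (add f g)
  then show ?case by (metis add_diff_add dvd_add subst_add)
qed auto

lemma X_minus_dvd_iff:
  assumes "p \<in> Pol (- {j})"
  shows "X j - p dvd f \<longleftrightarrow> subst (X(j := p)) f = 0"
proof
  assume "X j - p dvd f"
  then obtain g where "f = (X j - p) * g" ..
  moreover have "subst (X(j := p)) p = p" using subst_cong[OF assms, of "X(j := p)" X] by simp
  ultimately show "subst (X(j := p)) f = 0" by simp
next
  assume "subst (X(j := p)) f = 0"
  then show "X j - p dvd f" using X_minus_dvd_diff_subst[of j p f] by simp
qed
subsection \<open>Dimensions\<close>

lemma linear_scaleI:
  assumes "\<And>f g. \<phi> (f + g) = \<phi> f + \<phi> g" "\<And>c f. \<phi> (const c * f) = const c * \<phi> f"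
  shows "Vector_Spaces.linear scale scale \<phi>"
  using assms by (simp add: Vector_Spaces.linear_iff scale_def cpoly.vector_space_axioms)

text \<open>Rank-nullity with the image described by a model: \<open>\<phi>\<close> maps
  \<open>V\<close> into the copy of \<open>A\<close> under \<open>\<mu>\<close>, and
  \<open>\<sigma>\<close> lifts each \<open>\<mu> a\<close> back into \<open>V\<close>. Lifts of a
  basis of \<open>A\<close> together with a basis of the kernel form a basis of
  \<open>V\<close>.\<close>

lemma dim_split:
  assumes lin: "Vector_Spaces.linear scale scale \<phi>" "Vector_Spaces.linear scale scale \<sigma>"
      "Vector_Spaces.linear scale scale \<mu>"
    and inj: "inj \<mu>"
    and V: "cpoly.subspace V" "finite W" "V \<subseteq> cpoly.span W"
    and A: "cpoly.subspace A" "finite U" "A \<subseteq> cpoly.span U"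
    and \<sigma>: "\<And>a. a \<in> A \<Longrightarrow> \<sigma> a \<in> V" "\<And>a. a \<in> A \<Longrightarrow> \<phi> (\<sigma> a) = \<mu> a"
    and \<phi>: "\<And>v. v \<in> V \<Longrightarrow> \<phi> v \<in> \<mu> ` A"
  shows "cpoly.dim V = cpoly.dim A + cpoly.dim {v \<in> V. \<phi> v = 0}"
proof -
  interpret \<phi>: Vector_Spaces.linear scale scale \<phi> by fact
  interpret \<sigma>: Vector_Spaces.linear scale scale \<sigma> by fact
  interpret \<mu>: Vector_Spaces.linear scale scale \<mu> by fact
  let ?K = "{v \<in> V. \<phi> v = 0}"
  have K: "cpoly.subspace ?K"
    using V(1) by (auto simp: cpoly.subspace_def \<phi>.add \<phi>.scale)
  obtain B where B: "B \<subseteq> A" "cpoly.independent B" "A \<subseteq> cpoly.span B" "card B = cpoly.dim A"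
    using cpoly.basis_exists .
  have "finite B" using cpoly.independent_span_bound[OF A(2) B(2)] B(1) A(3) by blast
  obtain C where C: "C \<subseteq> ?K" "cpoly.independent C" "?K \<subseteq> cpoly.span C" "card C = cpoly.dim ?K"
    using cpoly.basis_exists .
  have "finite C" using cpoly.independent_span_bound[OF V(2) C(2)] C(1) V(3) by blast
  have spC: "cpoly.span C = ?K" by (rule cpoly.span_subspace[OF C(1,3) K])
  \<comment> \<open>Cardinality is carried along with independence, because lifts of distinct basis
    vectors must also be shown distinct from each other and from \<open>C\<close>.\<close>
  have step: "cpoly.independent (\<sigma> ` F \<union> C) \<and> card (\<sigma> ` F \<union> C) = card F + card C"
    if "finite F" "F \<subseteq> B" for F
    using that
  proof (induction F rule: finite_induct)
    case empty
    then show ?case using C by simp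
  next
    case (insert b F)
    have "\<sigma> b \<notin> cpoly.span (\<sigma> ` F \<union> C)"
    proof
      assume "\<sigma> b \<in> cpoly.span (\<sigma> ` F \<union> C)"
      then obtain x y where xy: "\<sigma> b = x + y" "x \<in> cpoly.span (\<sigma> ` F)" "y \<in> ?K"
        by (auto simp: cpoly.span_Un spC)
      then obtain a where a: "x = \<sigma> a" "a \<in> cpoly.span F" by (auto simp: \<sigma>.span_image)
      have "cpoly.span F \<subseteq> A" using insert.prems B(1) A(1) by (intro cpoly.span_minimal) auto
      then have "a \<in> A" using a by auto
      \<comment> \<open>Applying \<open>\<phi>\<close> discards the kernel part \<open>y\<close> of
        a dependence, which leaves a dependence inside \<open>A\<close>.\<close>
      have "\<mu> b = \<phi> (\<sigma> b)" using insert.prems B(1) \<sigma>(2)[of b] by auto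
      also have "\<dots> = \<mu> a" using xy a \<sigma>(2)[OF \<open>a \<in> A\<close>] by (simp add: \<phi>.add)
      finally have "b = a" using inj by (simp add: inj_eq)
      then have "cpoly.dependent (insert b F)"
        using a(2) insert.hyps cpoly.dependent_def by fastforce
      then show False using B(2) insert.prems cpoly.independent_mono by blast
    qed
    moreover from this have notin: "\<sigma> b \<notin> \<sigma> ` F \<union> C"
      using cpoly.span_base[of "\<sigma> b" "\<sigma> ` F \<union> C"] by argo
    moreover have "cpoly.independent (\<sigma> ` F \<union> C) \<and> card (\<sigma> ` F \<union> C) = card F + card C"
      using insert.IH insert.prems by simp
    ultimately show ?case using insert.hyps \<open>finite C\<close>
      by (simp add: cpoly.independent_insert del: Un_iff)
  qed
  show ?thesis
  proof (rule cpoly.dim_unique[where B="\<sigma> ` B \<union> C"])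
    show "\<sigma> ` B \<union> C \<subseteq> V" using B C \<sigma>(1) by blast
    show "V \<subseteq> cpoly.span (\<sigma> ` B \<union> C)"
    proof
      fix v assume "v \<in> V"
      then obtain a where a: "a \<in> A" "\<phi> v = \<mu> a" using \<phi> by blast
      \<comment> \<open>Subtracting the lift of its own image moves \<open>v\<close> into the
        kernel.\<close>
      have "v - \<sigma> a \<in> ?K" using a \<open>v \<in> V\<close> V(1) \<sigma>[OF a(1)] by (simp add: cpoly.subspace_diff \<phi>.diff)
      then have "v - \<sigma> a \<in> cpoly.span (\<sigma> ` B \<union> C)" using spC cpoly.span_mono[of C "\<sigma> ` B \<union> C"] by blast
      moreover have "\<sigma> a \<in> cpoly.span (\<sigma> ` B)" using a B(3) by (auto simp: \<sigma>.span_image)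
      then have "\<sigma> a \<in> cpoly.span (\<sigma> ` B \<union> C)" using cpoly.span_mono[of "\<sigma> ` B" "\<sigma> ` B \<union> C"] by blast
      ultimately show "v \<in> cpoly.span (\<sigma> ` B \<union> C)"
        using cpoly.span_add[of "v - \<sigma> a" _ "\<sigma> a"] by simp
    qed
    show "cpoly.independent (\<sigma> ` B \<union> C)" using step[OF \<open>finite B\<close>] by simp
    show "card (\<sigma> ` B \<union> C) = cpoly.dim A + cpoly.dim {v \<in> V. \<phi> v = 0}"
      using step[OF \<open>finite B\<close>] B C by simp
  qed
qed

lemma dim_zero: "cpoly.dim {0} = 0"
  by (rule cpoly.dim_unique[where B="{}"]) (auto simp: cpoly.independent_empty)

text \<open>The case of \<open>dim_split\<close> where \<open>\<phi>\<close> is the identity, so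
  that the kernel is zero.\<close>

lemma dim_inj_image:
  assumes lin: "Vector_Spaces.linear scale scale \<mu>" and inj: "inj \<mu>"
    and A: "cpoly.subspace A" "finite U" "A \<subseteq> cpoly.span U"
  shows "cpoly.dim (\<mu> ` A) = cpoly.dim A"
proof -
  interpret \<mu>: Vector_Spaces.linear scale scale \<mu> by fact
  have "cpoly.dim (\<mu> ` A) = cpoly.dim A + cpoly.dim {v \<in> \<mu> ` A. v = 0}"
  proof (rule dim_split[where W="\<mu> ` U"])
    show "Vector_Spaces.linear scale scale (\<lambda>v. v)" by (rule linear_scaleI) auto
    show "\<mu> ` A \<subseteq> cpoly.span (\<mu> ` U)" using A by (auto simp: \<mu>.span_image)
  qed (use assms in \<open>auto intro: \<mu>.subspace_image\<close>)
  moreover have "{v \<in> \<mu> ` A. v = 0} = {0}" using A(1) by (auto simp: cpoly.subspace_0 intro!: image_eqI[of _ _ 0])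
  ultimately show ?thesis by (simp add: dim_zero)
qed

text \<open>The sums of all monomials in one fibre of \<open>c\<close> form a basis of
  \<open>V\<close>. With \<open>c\<close> the identity this bounds spaces of forms; with
  \<open>c\<close> the multiset of exponents it counts symmetric forms.\<close>

lemma class_functions:
  fixes c :: "monom \<Rightarrow> 'a"
  assumes "finite M"
    and V: "V = {f. kys f \<subseteq> M \<and> (\<forall>m\<in>M. \<forall>m'\<in>M. c m = c m' \<longrightarrow> lkp f m = lkp f m')}"
  shows dim_class_functions: "cpoly.dim V = card (c ` M)"
    and class_functions_finite_span: "\<exists>W. finite W \<and> V \<subseteq> cpoly.span W"
proof -
  define b where "b i = (\<Sum>m | m \<in> M \<and> c m = i. Poly_Mapping.single m (1::complex))" for i
  have lb: "lkp (b i) m = (if m \<in> M \<and> c m = i then 1 else 0)" for i m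
  proof -
    have "lkp (b i) m = (\<Sum>k | k \<in> M \<and> c k = i. if k = m then 1 else 0)"
      unfolding b_def lookup_sum by (intro sum.cong) (auto simp: lookup_single when_def)
    then show ?thesis using \<open>finite M\<close> by simp
  qed
  have inj: "inj_on b (c ` M)"
  proof (rule inj_onI)
    fix i j assume "i \<in> c ` M" "j \<in> c ` M" and eq: "b i = b j"
    then obtain m where "m \<in> M" "c m = i" by auto
    then show "i = j" using lb[of i m] lb[of j m] eq by (auto split: if_splits)
  qed
  have sum_lkp: "lkp (\<Sum>i\<in>c ` M. scale (u i) (b i)) m = (if m \<in> M then u (c m) else 0)" for u m
  proof -
    have "lkp (\<Sum>i\<in>c ` M. scale (u i) (b i)) m = (\<Sum>i\<in>c ` M. if i = c m then (if m \<in> M then u i else 0) else 0)"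
      unfolding lookup_sum by (intro sum.cong) (auto simp: scale_def lookup_const_mult lb)
    then show ?thesis using \<open>finite M\<close> by simp
  qed
  let ?B = "b ` c ` M"
  have VB: "V \<subseteq> cpoly.span ?B"
  proof
    fix f assume f: "f \<in> V"
    \<comment> \<open>The coordinate at class \<open>i\<close> is read off at a chosen
      representative of the class.\<close>
    define u where "u i = lkp f (SOME m. m \<in> M \<and> c m = i)" for i
    have "f = (\<Sum>i\<in>c ` M. scale (u i) (b i))"
    proof (rule poly_mapping_eqI)
      fix m
      show "lkp f m = lkp (\<Sum>i\<in>c ` M. scale (u i) (b i)) m"
      proof (cases "m \<in> M")
        case True
        let ?m = "SOME m'. m' \<in> M \<and> c m' = c m"
        have "?m \<in> M \<and> c ?m = c m" by (rule someI[of _ m]) (use True in auto)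
        moreover have "lkp f k = lkp f k'" if "k \<in> M" "k' \<in> M" "c k = c k'" for k k'
          using f that unfolding V by blast
        ultimately have "lkp f m = u (c m)" using True unfolding u_def by metis
        then show ?thesis using True by (simp add: sum_lkp)
      next
        case False
        then show ?thesis using f V by (auto simp: sum_lkp in_keys_iff)
      qed
    qed
    also have "\<dots> \<in> cpoly.span ?B"
      by (intro cpoly.span_sum cpoly.span_scale cpoly.span_base) auto
    finally show "f \<in> cpoly.span ?B" .
  qed
  show "\<exists>W. finite W \<and> V \<subseteq> cpoly.span W" using VB \<open>finite M\<close> by blast
  show "cpoly.dim V = card (c ` M)"
  proof (rule cpoly.dim_unique[OF _ VB])
    show "?B \<subseteq> V" by (auto simp: V lb in_keys_iff split: if_splits)
    show "card ?B = card (c ` M)" by (rule card_image[OF inj])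
    show "cpoly.independent ?B"
    proof (rule cpoly.independent_if_scalars_zero)
      show "finite ?B" using \<open>finite M\<close> by simp
      fix u x assume 0: "(\<Sum>x\<in>?B. scale (u x) x) = 0" and "x \<in> ?B"
      then obtain m where m: "m \<in> M" "x = b (c m)" by auto
      have "(\<Sum>i\<in>c ` M. scale (u (b i)) (b i)) = 0" using 0 by (simp add: sum.reindex[OF inj])
      then show "u x = 0" using sum_lkp[of "u \<circ> b" m] m by simp
    qed
  qed
qed

subsection \<open>Hilbert series of symmetric polynomials\<close>

definition Sym :: "nat set \<Rightarrow> nat set \<Rightarrow> cpoly set" where
  "Sym S V = {f \<in> Pol V. \<forall>\<sigma>. \<sigma> permutes S \<longrightarrow> subst (\<lambda>i. X (\<sigma> i)) f = f}"

definition Mon :: "nat set \<Rightarrow> nat \<Rightarrow> monom set" where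
  "Mon V d = {m. kys m \<subseteq> V \<and> total_degree m = d}"

lemma total_degree_superset:
  "finite V \<Longrightarrow> kys m \<subseteq> V \<Longrightarrow> total_degree m = (\<Sum>i\<in>V. lkp m i)"
  unfolding total_degree_def by (rule sum.mono_neutral_left) (auto simp: in_keys_iff)

lemma finite_Mon:
  assumes "finite V"
  shows "finite (Mon V d)"
proof (rule inj_on_finite[of lkp])
  show "inj_on lkp (Mon V d)" by (auto intro!: inj_onI)
  show "finite {f::nat \<Rightarrow> nat. \<forall>i. (i \<in> V \<longrightarrow> f i \<in> {..d}) \<and> (i \<notin> V \<longrightarrow> f i = 0)}"
    using assms by (intro finite_set_of_finite_funs) auto
  have "lkp m i \<le> d" if "m \<in> Mon V d" "i \<in> V" for m i
    using that member_le_sum[of i V "lkp m"] assms by (auto simp: Mon_def total_degree_superset)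
  then show "lkp ` Mon V d \<subseteq> {f. \<forall>i. (i \<in> V \<longrightarrow> f i \<in> {..d}) \<and> (i \<notin> V \<longrightarrow> f i = 0)}"
    by (auto simp: Mon_def in_keys_iff)
qed

lemma Pol_homogeneous_iff: "f \<in> Pol V \<and> homogeneous d f \<longleftrightarrow> kys f \<subseteq> Mon V d"
  by (auto simp: Pol_def homogeneous_def Mon_def)

lemma Pol_homogeneous_finite_span:
  assumes "finite V"
  obtains W where "finite W" "{f \<in> Pol V. homogeneous d f} \<subseteq> cpoly.span W"
proof -
  have "{f \<in> Pol V. homogeneous d f} =
      {f. kys f \<subseteq> Mon V d \<and> (\<forall>m\<in>Mon V d. \<forall>m'\<in>Mon V d. m = m' \<longrightarrow> lkp f m = lkp f m')}"
    by (auto simp: Pol_homogeneous_iff[symmetric])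
  from class_functions_finite_span[OF finite_Mon[OF assms] this] that show ?thesis by blast
qed

text \<open>Permuting variables turns the exponent \<open>k\<close> into \<open>k\<close> composed
  with \<open>inv \<sigma>\<close>, so the coefficient at \<open>m\<close> is the old one at
  \<open>m\<close> composed with \<open>\<sigma>\<close>.\<close>

lemma lookup_subst_permute:
  assumes "bij \<sigma>"
  shows "lkp (subst (\<lambda>i. X (\<sigma> i)) f) m = lkp f (Poly_Mapping.map_key \<sigma> m)"
proof (induction f rule: cpoly_induct_single)
  case (single k c)
  have inj: "inj \<sigma>" "inj (inv \<sigma>)" using assms by (auto simp: bij_is_inj bij_imp_bij_inv)
  let ?k = "Poly_Mapping.map_key (inv \<sigma>) k"
  have "kys ?k = \<sigma> ` kys k"
    using assms inj by (simp add: keys_map_key bij_vimage_eq_inv_image bij_imp_bij_inv inv_inv_eq)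
  then have "mon X ?k = (\<Prod>i\<in>\<sigma> ` kys k. X i ^ lkp k (inv \<sigma> i))"
    unfolding mon_def by (simp add: map_key.rep_eq inj)
  also have "\<dots> = mon (\<lambda>i. X (\<sigma> i)) k"
    unfolding mon_def by (subst prod.reindex) (use inj in \<open>auto intro: inj_on_subset\<close>)
  finally have "mon X ?k = mon (\<lambda>i. X (\<sigma> i)) k" .
  then have "subst (\<lambda>i. X (\<sigma> i)) (Poly_Mapping.single k c) = Poly_Mapping.single ?k c"
    by (simp only: subst_single single_eq_mon[of ?k c])
  moreover have "?k = m \<longleftrightarrow> k = Poly_Mapping.map_key \<sigma> m"
    using assms inj by (auto simp: map_key_compose bij_is_surj surj_iff[symmetric] map_key_id inv_o_cancel comp_def
       bij_is_inj inv_f_f surj_f_inv_f)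
  ultimately show ?case by (simp add: lookup_single when_def)
qed (simp add: lookup_add)

text \<open>Two monomials lie in one orbit of the permutations of \<open>S\<close> exactly when
  their multisets of exponents agree. Invariance therefore means that coefficients are constant on
  the fibres of \<open>c\<close>.\<close>

lemma Sym_homogeneous_eq:
  assumes "finite S"
  defines "c \<equiv> \<lambda>m. image_mset (lkp m) (mset_set S)"
  shows "{f \<in> Sym S S. homogeneous d f} =
    {f. kys f \<subseteq> Mon S d \<and> (\<forall>m\<in>Mon S d. \<forall>m'\<in>Mon S d. c m = c m' \<longrightarrow> lkp f m = lkp f m')}"
    (is "?A = ?B")
proof (intro equalityI subsetI)
  fix f assume f: "f \<in> ?A"
  have "lkp f m = lkp f m'" if mm: "m \<in> Mon S d" "m' \<in> Mon S d" "c m = c m'" for m m'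
  proof -
    obtain p where p: "p permutes S" "\<forall>x\<in>S. lkp m x = lkp m' (p x)"
      using image_mset_eq_implies_permutes[OF \<open>finite S\<close> mm(3)[unfolded c_def]] .
    have bij: "bij p" using p(1) by (rule permutes_bij)
    have "m = Poly_Mapping.map_key p m'"
    proof (rule poly_mapping_eqI)
      fix x
      show "lkp m x = lkp (Poly_Mapping.map_key p m') x"
      proof (cases "x \<in> S")
        case False
        then have "lkp m x = 0" "lkp m' x = 0" using mm by (auto simp: Mon_def in_keys_iff)
        then show ?thesis using False p(1) bij by (simp add: map_key.rep_eq bij_is_inj permutes_not_in)
      qed (use p(2) bij in \<open>simp add: map_key.rep_eq bij_is_inj\<close>)
    qed
    moreover have "subst (\<lambda>i. X (p i)) f = f" using f p(1) by (simp add: Sym_def)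
    ultimately show ?thesis using lookup_subst_permute[OF bij, of f m'] by simp
  qed
  moreover have "kys f \<subseteq> Mon S d" using f Pol_homogeneous_iff[of f S d] by (simp add: Sym_def)
  ultimately show "f \<in> ?B" by blast
next
  fix f assume f: "f \<in> ?B"
  then have fS: "f \<in> Pol S" "homogeneous d f" using Pol_homogeneous_iff[of f S d] by auto
  have "subst (\<lambda>i. X (\<sigma> i)) f = f" if \<sigma>: "\<sigma> permutes S" for \<sigma>
  proof (rule poly_mapping_eqI)
    fix m :: monom
    have bij: "bij \<sigma>" using \<sigma> by (rule permutes_bij)
    let ?m = "Poly_Mapping.map_key \<sigma> m"
    have keys: "kys ?m = \<sigma> -` kys m" using bij by (simp add: keys_map_key bij_is_inj)
    have sub: "kys ?m \<subseteq> S \<longleftrightarrow> kys m \<subseteq> S"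
    proof -
      have "kys ?m \<subseteq> S \<longleftrightarrow> (\<forall>x. \<sigma> x \<in> kys m \<longrightarrow> \<sigma> x \<in> S)" using keys \<sigma> by (auto simp: permutes_in_image)
      also have "\<dots> \<longleftrightarrow> kys m \<subseteq> S" using bij by (metis bij_pointE subset_iff)
      finally show ?thesis .
    qed
    have lm: "lkp ?m i = lkp m (\<sigma> i)" for i using bij by (simp add: map_key.rep_eq bij_is_inj)
    have deg: "total_degree ?m = total_degree m" if "kys m \<subseteq> S"
    proof -
      have "total_degree ?m = (\<Sum>i\<in>S. lkp ?m i)" using that sub assms(1) by (intro total_degree_superset) auto
      also have "\<dots> = (\<Sum>i\<in>S. lkp m i)"
        using sum.permute[OF \<sigma>, of "lkp m"] by (simp add: lm comp_def)
      also have "\<dots> = total_degree m" using that assms(1) by (intro total_degree_superset[symmetric])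
      finally show ?thesis .
    qed
    have "lkp f ?m = lkp f m"
    proof (cases "m \<in> Mon S d")
      case True
      then have "?m \<in> Mon S d" using sub deg by (simp add: Mon_def)
      moreover have "c ?m = c m"
      proof -
        have lm': "lkp ?m = lkp m \<circ> \<sigma>" using lm by auto
        have "c ?m = image_mset (lkp m) (image_mset \<sigma> (mset_set S))"
          by (simp add: c_def lm' multiset.map_comp)
        also have "image_mset \<sigma> (mset_set S) = mset_set S"
          using \<sigma> by (simp add: image_mset_mset_set permutes_inj_on permutes_image)
        finally show ?thesis by (simp add: c_def)
      qed
      ultimately show ?thesis using f True by blast
    next
      case False
      then have "?m \<notin> Mon S d" using sub deg by (auto simp: Mon_def)
      then have "?m \<notin> kys f" "m \<notin> kys f" using False f by auto
      then show ?thesis by (simp add: in_keys_iff)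
    qed
    then show "lkp (subst (\<lambda>i. X (\<sigma> i)) f) m = lkp f m" by (simp add: lookup_subst_permute[OF bij])
  qed
  then show "f \<in> ?A" using fS by (simp add: Sym_def)
qed

section \<open>Partitions and their generating function\<close>

text \<open>Zeros are allowed: these are the partitions of \<open>d\<close> into at most
  \<open>k\<close> parts, padded to length \<open>k\<close>, just as exponents of monomials may
  vanish.\<close>

definition partitions :: "nat \<Rightarrow> nat \<Rightarrow> nat multiset set" where
  "partitions k d = {N. size N = k \<and> sum_mset N = d}"

lemma image_mset_surj:
  assumes "finite S" "size N = card S"
  shows "\<exists>g. image_mset g (mset_set S) = N"
  using assms
proof (induction S arbitrary: N rule: finite_induct)
  case (insert a S)
  then obtain x N' where N: "N = add_mset x N'" by (metis card_insert_disjoint size_eq_Suc_imp_eq_union)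
  with insert obtain g where g: "image_mset g (mset_set S) = N'" by auto
  have "image_mset (g(a := x)) (mset_set (insert a S)) = N"
    using insert.hyps N g[symmetric] by (auto intro!: image_mset_cong)
  then show ?case by blast
qed simp

lemma image_Mon:
  assumes "finite S"
  shows "(\<lambda>m. image_mset (lkp m) (mset_set S)) ` Mon S d = partitions (card S) d"
proof (intro equalityI subsetI)
  fix N assume N: "N \<in> partitions (card S) d"
  then obtain g where g: "image_mset g (mset_set S) = N"
    using image_mset_surj[OF assms] by (auto simp: partitions_def)
  define m where "m = Abs_poly_mapping (\<lambda>i. if i \<in> S then g i else 0)"
  have lm: "lkp m i = (if i \<in> S then g i else 0)" for i
  proof -
    have "finite {i. (if i \<in> S then g i else 0) \<noteq> 0}"
      by (rule finite_subset[OF _ assms]) auto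
    then show ?thesis by (simp add: m_def)
  qed
  have im: "image_mset (lkp m) (mset_set S) = N"
    using assms g[symmetric] by (auto simp: lm intro!: image_mset_cong)
  have "kys m \<subseteq> S" by (auto simp: in_keys_iff lm split: if_splits)
  moreover have "total_degree m = d"
    using N im \<open>kys m \<subseteq> S\<close> assms by (simp add: total_degree_superset partitions_def sum_unfold_sum_mset)
  ultimately show "N \<in> (\<lambda>m. image_mset (lkp m) (mset_set S)) ` Mon S d"
    using im by (auto simp: Mon_def)
qed (use assms in \<open>auto simp: Mon_def partitions_def total_degree_superset sum_unfold_sum_mset\<close>)

lemma finite_partitions: "finite (partitions k d)"
  using image_Mon[of "{..<k}" d] finite_Mon[of "{..<k}" d] by (metis card_lessThan finite_imageI finite_lessThan)

lemma dim_Sym: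
  assumes "finite S"
  shows "cpoly.dim {f \<in> Sym S S. homogeneous d f} = card (partitions (card S) d)"
  using dim_class_functions[OF finite_Mon[OF assms] Sym_homogeneous_eq[OF assms]] image_Mon[OF assms] by simp

lemma partitions_0: "card (partitions 0 d) = (if d = 0 then 1 else 0)"
proof -
  have "partitions 0 d = (if d = 0 then {{#}} else {})" by (auto simp: partitions_def)
  then show ?thesis by simp
qed

text \<open>If 0 occurs, one copy of it is removed. Otherwise 1 is subtracted from each of the
  \<open>Suc k\<close> entries, which lowers the sum by \<open>Suc k\<close>.\<close>

lemma card_partitions_Suc:
  "card (partitions (Suc k) d) =
    card (partitions k d) + (if Suc k \<le> d then card (partitions (Suc k) (d - Suc k)) else 0)"
proof -
  let ?P0 = "{N \<in> partitions (Suc k) d. 0 \<in># N}" and ?P1 = "{N \<in> partitions (Suc k) d. 0 \<notin># N}"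
  have "card (partitions (Suc k) d) = card (?P0 \<union> ?P1)" by (rule arg_cong[of _ _ card]) auto
  also have "\<dots> = card ?P0 + card ?P1"
    by (rule card_Un_disjoint) (auto intro: finite_subset[OF _ finite_partitions])
  also have "?P0 = add_mset 0 ` partitions k d"
    by (auto simp: partitions_def dest!: multi_member_split)
  also have "card (add_mset 0 ` partitions k d) = card (partitions k d)"
    by (rule card_image) (auto simp: inj_on_def)
  also have "?P1 = (if Suc k \<le> d then image_mset Suc ` partitions (Suc k) (d - Suc k) else {})"
  proof -
    have sum_Suc: "sum_mset (image_mset Suc N) = sum_mset N + size N" for N
      by (induction N) auto
    have "N \<in> image_mset Suc ` partitions (Suc k) (d - Suc k) \<and> Suc k \<le> d" if N: "N \<in> ?P1" for N
    proof -
      have "image_mset Suc (image_mset (\<lambda>x. x - 1) N) = image_mset (\<lambda>x. x) N"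
        unfolding multiset.map_comp
      proof (rule image_mset_cong)
        fix x assume "x \<in># N"
        then have "x \<noteq> 0" using N by (cases "x = 0") auto
        then show "(Suc \<circ> (\<lambda>x. x - 1)) x = x" by simp
      qed
      then have N': "image_mset Suc (image_mset (\<lambda>x. x - 1) N) = N" by simp
      let ?N' = "image_mset (\<lambda>x. x - 1) N"
      have "d = sum_mset ?N' + Suc k"
        using sum_Suc[of ?N'] N unfolding N' by (simp add: partitions_def)
      then have "?N' \<in> partitions (Suc k) (d - Suc k)" "Suc k \<le> d" using N by (auto simp: partitions_def)
      then show ?thesis using N' by (metis imageI)
    qed
    moreover have "image_mset Suc N \<in> ?P1" if "N \<in> partitions (Suc k) (d - Suc k)" "Suc k \<le> d" for N
      using that by (auto simp: partitions_def sum_Suc)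
    ultimately show ?thesis by auto
  qed
  also have "card \<dots> = (if Suc k \<le> d then card (partitions (Suc k) (d - Suc k)) else 0)"
    by (auto intro!: card_image inj_on_subset[OF multiset.inj_map])
  finally show ?thesis .
qed

lemma qfac_Suc: "qfac (Suc k) = qfac k * (1 - fps_X ^ Suc k)"
  by (simp add: qfac_def atLeastAtMostSuc_conv mult.commute)

text \<open>The recurrence for \<open>partitions\<close> says that multiplication by
  \<open>1 - fps_X ^ Suc k\<close> lowers \<open>Suc k\<close> to \<open>k\<close>; the factors
  accumulate to \<open>qfac k\<close>.\<close>

lemma partitions_fps: "Abs_fps (\<lambda>d. of_nat (card (partitions k d))) * qfac k = 1"
proof (induction k)
  case 0
  show ?case by (intro fps_ext) (simp add: qfac_def partitions_0)
next
  case (Suc k)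
  have "Abs_fps (\<lambda>d. of_nat (card (partitions (Suc k) d))) * (1 - fps_X ^ Suc k) =
      (Abs_fps (\<lambda>d. of_nat (card (partitions k d))) :: rat fps)"
    by (intro fps_ext) (auto simp: right_diff_distrib fps_X_power_mult_right_nth
        card_partitions_Suc[of k] simp del: power_Suc)
  then show ?case using Suc by (simp only: qfac_Suc mult.left_commute[of _ "qfac k"] mult.commute[of _ "qfac k"])
qed

section \<open>Partially symmetric polynomials and one additional variable\<close>

lemma Sym_Pol: "f \<in> Sym S V \<Longrightarrow> f \<in> Pol V" by (simp add: Sym_def)
lemma Sym_subst: "f \<in> Sym S V \<Longrightarrow> \<sigma> permutes S \<Longrightarrow> subst (\<lambda>i. X (\<sigma> i)) f = f" by (simp add: Sym_def)
lemma Sym_0 [simp]: "0 \<in> Sym S V" by (simp add: Sym_def)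
lemma Sym_const [simp]: "const c \<in> Sym S V" by (simp add: Sym_def)
lemma Sym_add: "f \<in> Sym S V \<Longrightarrow> g \<in> Sym S V \<Longrightarrow> f + g \<in> Sym S V" by (simp add: Sym_def Pol_add)
lemma Sym_mult: "f \<in> Sym S V \<Longrightarrow> g \<in> Sym S V \<Longrightarrow> f * g \<in> Sym S V" by (simp add: Sym_def Pol_mult)
text \<open>Each permutation fixes \<open>g\<close> and \<open>g * h\<close>, so cancelling
  \<open>g\<close> shows that it fixes \<open>h\<close>.\<close>

lemma Sym_quotient:
  assumes "g * h \<in> Sym S V" "g \<in> Sym S V" "g \<noteq> 0"
  shows "h \<in> Sym S V"
proof -
  have "h \<in> Pol V" using assms Pol_quotient by (auto simp: Sym_def)
  moreover have "subst (\<lambda>i. X (\<sigma> i)) h = h" if "\<sigma> permutes S" for \<sigma>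
  proof -
    have "g * subst (\<lambda>i. X (\<sigma> i)) h = g * h"
      using Sym_subst[OF assms(1) that] Sym_subst[OF assms(2) that] by simp
    then show ?thesis using \<open>g \<noteq> 0\<close> by simp
  qed
  ultimately show ?thesis by (simp add: Sym_def)
qed

lemma subspaceI:
  assumes "0 \<in> V" "\<And>f g. f \<in> V \<Longrightarrow> g \<in> V \<Longrightarrow> f + g \<in> V" "\<And>c f. f \<in> V \<Longrightarrow> const c * f \<in> V"
  shows "cpoly.subspace V"
  using assms by (auto simp: cpoly.subspace_def scale_def)

lemma subspace_Sym: "cpoly.subspace {f \<in> Sym S V. homogeneous d f}"
  by (rule subspaceI) (auto intro: Sym_add Sym_mult homogeneous_add homogeneous_const_mult)

lemma Sym_finite_span:
  assumes "finite V"
  obtains W where "finite W" "{f \<in> Sym S V. homogeneous d f} \<subseteq> cpoly.span W"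
proof -
  obtain W where "finite W" "{f \<in> Pol V. homogeneous d f} \<subseteq> cpoly.span W"
    using Pol_homogeneous_finite_span[OF assms] .
  then show ?thesis using that Sym_Pol by blast
qed

lemma linear_subst: "Vector_Spaces.linear scale scale (subst s)"
  by (rule linear_scaleI) auto

lemma linear_mult: "Vector_Spaces.linear scale scale ((*) g)"
  by (rule linear_scaleI) (auto simp: algebra_simps)

lemma linear_id: "Vector_Spaces.linear scale scale (\<lambda>f. f)"
  by (rule linear_scaleI) auto

lemma X_neq_0 [simp]: "X i \<noteq> 0"
  using X_inj[of i "Suc i"] subst_X[of "\<lambda>j. if j = i then 1 else 0" i] by (metis subst_0 zero_neq_one)

lemma inj_mult: "g \<noteq> (0 :: cpoly) \<Longrightarrow> inj ((*) g)" by (auto intro!: injI)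

text \<open>Setting \<open>X z\<close> to 0 maps onto the forms symmetric in \<open>S\<close> alone,
  with inclusion as a section. Its kernel consists of the multiples of \<open>X z\<close>, which
  have quotients of degree \<open>d - 1\<close> and are all zero when \<open>d = 0\<close>.\<close>

lemma dim_Sym_insert:
  assumes "finite S" "z \<notin> S"
  shows "cpoly.dim {f \<in> Sym S (insert z S). homogeneous d f} =
    card (partitions (card S) d) +
    (if d = 0 then 0 else cpoly.dim {f \<in> Sym S (insert z S). homogeneous (d - 1) f})"
    (is "cpoly.dim ?V = _ + (if _ then _ else cpoly.dim ?W)")
proof -
  let ?r = "subst (X(z := 0))" and ?A = "{f \<in> Sym S S. homogeneous d f}"
  have fin: "finite (insert z S)" using assms by simp
  obtain U where U: "finite U" "?V \<subseteq> cpoly.span U" using Sym_finite_span[OF fin] .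
  obtain U' where U': "finite U'" "?A \<subseteq> cpoly.span U'" using Sym_finite_span[OF assms(1)] .
  have "cpoly.dim ?V = cpoly.dim ?A + cpoly.dim {f \<in> ?V. ?r f = 0}"
  proof (rule dim_split[OF linear_subst linear_id linear_id _ subspace_Sym U subspace_Sym U'])
    fix a assume a: "a \<in> ?A"
    show "a \<in> ?V" using a by (auto simp: Sym_def intro: Pol_mono)
    have "a \<in> Pol S" using a by (simp add: Sym_def)
    then show "?r a = a" using assms(2) by (subst subst_cong[of a S _ X]) auto
  next
    fix f assume f: "f \<in> ?V"
    have "?r f \<in> Pol S"
      using f by (intro Pol_subst[of f "insert z S"]) (auto simp: Sym_def intro: Pol_X)
    moreover have "homogeneous d (?r f)"
      using f homogeneous_X by (intro homogeneous_subst) auto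
    moreover have "subst (\<lambda>i. X (\<sigma> i)) (?r f) = ?r f" if \<sigma>: "\<sigma> permutes S" for \<sigma>
    proof -
      have "\<sigma> i = z \<longleftrightarrow> i = z" for i
        using permutes_not_in[OF \<sigma> assms(2)] inj_eq[OF permutes_inj[OF \<sigma>], of i z] by simp
      then have "subst (\<lambda>i. X (\<sigma> i)) (?r f) = ?r (subst (\<lambda>i. X (\<sigma> i)) f)"
        unfolding subst_subst by (intro arg_cong[of _ _ "\<lambda>s. subst s f"]) auto
      then show ?thesis using f \<sigma> by (simp add: Sym_def)
    qed
    ultimately show "?r f \<in> (\<lambda>f. f) ` ?A" by (simp add: Sym_def)
  qed auto
  moreover have "cpoly.dim {f \<in> ?V. ?r f = 0} = (if d = 0 then 0 else cpoly.dim ?W)"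
  proof -
    have dvd: "\<exists>g. f = X z * g" if "?r f = 0" for f
      using X_minus_dvd_diff_subst[of z 0 f] that by (auto simp: dvd_def)
    have Xz: "X z \<in> Sym S (insert z S)"
      using assms(2) by (auto simp: Sym_def Pol_X permutes_not_in)
    show ?thesis
    proof (cases "d = 0")
      case True
      have "f = 0" if f: "f \<in> ?V" "?r f = 0" for f
      proof -
        obtain g where "f = X z * g" using dvd[OF f(2)] ..
        then show ?thesis using f(1) True homogeneous_mult_less_eq_0[of 0 "X z" g 1] homogeneous_X by auto
      qed
      then have "{f \<in> ?V. ?r f = 0} = {0}" by auto
      then show ?thesis using True by (simp add: dim_zero)
    next
      case False
      have "{f \<in> ?V. ?r f = 0} = (*) (X z) ` ?W"
      proof (intro equalityI subsetI)
        fix f assume f: "f \<in> {f \<in> ?V. ?r f = 0}"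
        then obtain g where g: "f = X z * g" using dvd by blast
        have "g \<in> Sym S (insert z S)" using f g Xz Sym_quotient[of "X z" g] by auto
        moreover have "homogeneous (d - 1) g"
          using f g False homogeneous_X homogeneous_quotient[of 1 "d - 1" "X z" g] by auto
        ultimately show "f \<in> (*) (X z) ` ?W" using g by auto
      next
        fix f assume "f \<in> (*) (X z) ` ?W"
        then obtain g where "f = X z * g" "g \<in> ?W" by auto
        then show "f \<in> {f \<in> ?V. ?r f = 0}"
          using Sym_mult[OF Xz, of g] homogeneous_mult[OF homogeneous_X, of "d - 1" g z] False by simp
      qed
      moreover obtain U where "finite U" "?W \<subseteq> cpoly.span U" using Sym_finite_span[OF fin] .
      ultimately show ?thesis
        using False dim_inj_image[OF linear_mult inj_mult[OF X_neq_0] subspace_Sym, of U S "insert z S" "d - 1" z] by simp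
    qed
  qed
  ultimately show ?thesis by (simp add: dim_Sym[OF assms(1)])
qed

lemma Sym_fps:
  assumes "finite S"
  shows "Abs_fps (\<lambda>d. of_nat (cpoly.dim {f \<in> Sym S S. homogeneous d f})) * qfac (card S) = 1"
  using partitions_fps[of "card S"] by (simp add: dim_Sym[OF assms])

text \<open>The recurrence of \<open>dim_Sym_insert\<close> amounts to multiplication by
  \<open>1 - fps_X\<close>, which is \<open>qfac 1\<close>.\<close>

lemma Sym_insert_fps:
  assumes "finite S" "z \<notin> S"
  shows "Abs_fps (\<lambda>d. of_nat (cpoly.dim {f \<in> Sym S (insert z S). homogeneous d f})) *
    (qfac 1 * qfac (card S)) = 1"
proof -
  let ?G = "Abs_fps (\<lambda>d. of_nat (cpoly.dim {f \<in> Sym S (insert z S). homogeneous d f})) :: rat fps"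
  have "?G * (1 - fps_X) = Abs_fps (\<lambda>d. of_nat (card (partitions (card S) d)))"
  proof (rule fps_ext)
    fix d
    show "fps_nth (?G * (1 - fps_X)) d = fps_nth (Abs_fps (\<lambda>d. of_nat (card (partitions (card S) d)))) d"
      using dim_Sym_insert[OF assms, of d] by (simp add: right_diff_distrib)
  qed
  moreover have "qfac 1 = 1 - fps_X" by (simp add: qfac_def)
  ultimately show ?thesis using partitions_fps[of "card S"] by (simp add: mult.assoc[symmetric])
qed

section \<open>Degree shift by a fixed homogeneous factor\<close>

text \<open>Placing the degree condition on the product makes sense for every \<open>d\<close>:
  below degree \<open>e\<close> only \<open>a = 0\<close> satisfies it, and this is where the
  truncated \<open>d - e\<close> would mislead.\<close>

lemma dim_shift:
  assumes "homogeneous e D" "D \<noteq> 0"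
  shows "cpoly.dim {a \<in> Sym S V. homogeneous d (D * a)} =
    (if e \<le> d then cpoly.dim {a \<in> Sym S V. homogeneous (d - e) a} else 0)"
proof (cases "e \<le> d")
  case True
  have "homogeneous d (D * a) \<longleftrightarrow> homogeneous (d - e) a" for a
    using homogeneous_quotient[of e "d - e" D a] homogeneous_mult[of e D "d - e" a] assms True by auto
  then show ?thesis using True by simp
next
  case False
  have "homogeneous d (D * a) \<longleftrightarrow> a = 0" for a
    using homogeneous_mult_less_eq_0[of d D a e] assms False by auto
  then have "{a \<in> Sym S V. homogeneous d (D * a)} = {0}" by auto
  then show ?thesis using False by (simp add: dim_zero)
qed

lemma shift_fps:
  assumes "homogeneous e D" "D \<noteq> 0"
  shows "Abs_fps (\<lambda>d. of_nat (cpoly.dim {a \<in> Sym S V. homogeneous d (D * a)})) =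
    (fps_X ^ e * Abs_fps (\<lambda>d. of_nat (cpoly.dim {a \<in> Sym S V. homogeneous d a})) :: rat fps)"
  by (rule fps_ext) (simp add: dim_shift[OF assms] fps_X_power_mult_nth)

subsection \<open>Divisibility by powers of differences of variables\<close>

text \<open>Divisibility by \<open>X i - X j\<close> is the vanishing of a ring homomorphism into a
  domain, so it passes from a product to one of the factors.\<close>

lemma prime_elem_diff:
  assumes "i \<noteq> j"
  shows "prime_elem (X i - X j)"
proof (rule prime_elemI)
  have *: "X i - X j dvd f \<longleftrightarrow> subst (X(i := X j)) f = 0" for f
    using assms by (intro X_minus_dvd_iff Pol_X) auto
  show "X i - X j \<noteq> 0" using assms by simp
  show "\<not> X i - X j dvd 1" by (simp add: *)
  show "X i - X j dvd a \<or> X i - X j dvd b" if "X i - X j dvd a * b" for a b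
    using that by (simp add: *)
qed

lemma prime_elem_power_dvd_mult:
  fixes p :: "'a :: idom"
  assumes "prime_elem p" "p ^ k dvd a * b" "\<not> p dvd a"
  shows "p ^ k dvd b"
  using assms(2)
proof (induction k)
  case (Suc k)
  then have "p ^ k dvd b" by (meson dvd_trans le_imp_power_dvd le_SucI order_refl)
  then obtain c where c: "b = p ^ k * c" ..
  have "p ^ k * p dvd p ^ k * (a * c)" using Suc.prems c by (simp add: mult_ac)
  moreover have "p ^ k \<noteq> 0" using assms(1) by auto
  ultimately have "p dvd a * c" by (metis dvd_mult_cancel_left)
  then have "p dvd c" using assms(1,3) prime_elem_dvd_multD by blast
  then show ?case using c by (simp add: mult.commute mult_dvd_mono)
qed simp

text \<open>The primes are added one at a time. A new prime divides none of the earlier ones, hence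
  not their product, so its power must divide the remaining cofactor.\<close>

lemma prod_prime_elem_power_dvd:
  fixes f :: "'a :: idom"
  assumes "finite K" "\<And>k. k \<in> K \<Longrightarrow> prime_elem (q k)" "\<And>k. k \<in> K \<Longrightarrow> q k ^ e k dvd f"
    "\<And>k l. k \<in> K \<Longrightarrow> l \<in> K \<Longrightarrow> k \<noteq> l \<Longrightarrow> \<not> q k dvd q l"
  shows "(\<Prod>k\<in>K. q k ^ e k) dvd f"
  using assms
proof (induction K rule: finite_induct)
  case (insert k K)
  let ?Q = "\<Prod>k\<in>K. q k ^ e k"
  have p: "prime_elem (q k)" using insert.prems by simp
  have "?Q dvd f" by (rule insert.IH) (use insert.prems in auto)
  then obtain c where c: "f = ?Q * c" ..
  have "\<not> q k dvd ?Q"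
  proof
    assume "q k dvd ?Q"
    then obtain l where "l \<in> K" "q k dvd q l ^ e l"
      using p \<open>finite K\<close>
      by (induction K rule: infinite_finite_induct) (auto dest: prime_elem_dvd_multD simp: prime_elem_not_unit)
    then have "q k dvd q l" using p prime_elem_dvd_power by blast
    then show False using insert.prems(3)[of k l] insert.hyps \<open>l \<in> K\<close> by auto
  qed
  moreover have "q k ^ e k dvd ?Q * c" using insert.prems(2)[of k] c by simp
  ultimately have "q k ^ e k dvd c" using prime_elem_power_dvd_mult[OF p] by blast
  then show ?case using insert.hyps c by (simp add: mult.commute mult_dvd_mono)
qed simp

text \<open>The product runs over ordered pairs, so up to sign this is the product of the squared differences.\<close>

definition Disc :: "nat set \<Rightarrow> cpoly" where
  "Disc S = (\<Prod>i\<in>S. \<Prod>j\<in>S - {i}. X i - X j)"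

lemma subst_Disc:
  assumes "inj_on \<pi> S"
  shows "subst (\<lambda>i. X (\<pi> i)) (Disc S) = Disc (\<pi> ` S)"
proof -
  have inner: "(\<Prod>j\<in>S - {i}. X (\<pi> i) - X (\<pi> j)) = (\<Prod>j\<in>\<pi> ` S - {\<pi> i}. X (\<pi> i) - X j)" if "i \<in> S" for i
  proof -
    have "\<pi> ` S - {\<pi> i} = \<pi> ` (S - {i})" using that assms by (auto simp: inj_on_def)
    moreover have "inj_on \<pi> (S - {i})" using assms by (rule inj_on_subset) auto
    ultimately show ?thesis by (simp add: prod.reindex)
  qed
  show ?thesis
    unfolding Disc_def by (simp add: inner prod.reindex[OF assms])
qed

lemma Disc_nonzero [simp]: "finite S \<Longrightarrow> Disc S \<noteq> 0"
  by (auto simp: Disc_def)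

lemma homogeneous_diff_X: "homogeneous 1 (X i - X j)"
  by (intro homogeneous_diff homogeneous_X)

lemma homogeneous_Disc:
  assumes "finite S"
  shows "homogeneous (card S * (card S - 1)) (Disc S)"
proof -
  have "homogeneous (\<Sum>i\<in>S. \<Sum>j\<in>S - {i}. 1) (Disc S)"
    unfolding Disc_def by (intro homogeneous_prod homogeneous_diff_X)
  then show ?thesis using assms by simp
qed

lemma Disc_Pol: "S \<subseteq> V \<Longrightarrow> Disc S \<in> Pol V"
  unfolding Disc_def by (intro Pol_prod Pol_diff Pol_X) auto

text \<open>Each \<open>X i - X j\<close> is paired with \<open>X j - X i\<close>, whose product is
  minus a square. Stating divisibility absorbs the signs.\<close>

lemma Disc_dvd:
  assumes "finite S"
  shows "Disc S dvd (\<Prod>(i,j)\<in>{(i,j). i \<in> S \<and> j \<in> S \<and> i < j}. (X i - X j) ^ 2)"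
proof -
  let ?L = "{(i,j). i \<in> S \<and> j \<in> S \<and> i < j}" and ?G = "{(i,j). i \<in> S \<and> j \<in> S \<and> j < i}"
  have fin: "finite ?L" "finite ?G" by (rule finite_subset[of _ "S \<times> S"]; use assms in auto)+
  have "Disc S = (\<Prod>(i,j)\<in>Sigma S (\<lambda>i. S - {i}). X i - X j)"
    unfolding Disc_def using assms by (subst prod.Sigma) auto
  also have "Sigma S (\<lambda>i. S - {i}) = ?L \<union> ?G" by auto
  also have "(\<Prod>(i,j)\<in>?L \<union> ?G. X i - X j) = (\<Prod>(i,j)\<in>?L. X i - X j) * (\<Prod>(i,j)\<in>?G. X i - X j)"
    using fin by (intro prod.union_disjoint) auto
  also have "(\<Prod>(i,j)\<in>?G. X i - X j) = (\<Prod>(i,j)\<in>?L. X j - X i)"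
    by (rule prod.reindex_bij_witness[of _ "\<lambda>(i,j). (j,i)" "\<lambda>(i,j). (j,i)"]) auto
  also have "(\<Prod>(i,j)\<in>?L. X i - X j) * \<dots> = (\<Prod>(i,j)\<in>?L. (X i - X j) * (X j - X i))"
    by (simp add: prod.distrib[symmetric] case_prod_unfold)
  also have "\<dots> dvd (\<Prod>(i,j)\<in>?L. (X i - X j) ^ 2)"
  proof (rule prod_dvd_prod, safe)
    fix i j :: nat
    have "(X i - X j) ^ 2 = ((X i - X j) * (X j - X i)) * (- 1)" by (simp add: power2_eq_square algebra_simps)
    then show "(X i - X j) * (X j - X i) dvd (X i - X j) ^ 2" by (metis dvd_triv_left)
  qed
  finally show ?thesis .
qed

text \<open>The swap fixes \<open>f\<close> and negates \<open>X i - X j\<close>, so it negates the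
  quotient \<open>g\<close>. On \<open>X i = X j\<close> this makes \<open>g\<close> equal to its
  own negative, hence zero, which supplies the second factor.\<close>

lemma square_dvd:
  assumes "i \<noteq> j" and swap: "subst (\<lambda>k. X (transpose i j k)) f = f" and van: "subst (X(i := X j)) f = 0"
  shows "(X i - X j) ^ 2 dvd f"
proof -
  have *: "X i - X j dvd h \<longleftrightarrow> subst (X(i := X j)) h = 0" for h
    using assms(1) by (intro X_minus_dvd_iff Pol_X) auto
  then obtain g where g: "f = (X i - X j) * g" using van by (auto simp: dvd_def)
  let ?g' = "subst (\<lambda>k. X (transpose i j k)) g"
  have "(X i - X j) * g = (X i - X j) * (- ?g')" using swap g by (simp add: algebra_simps)
  moreover have "X i - X j \<noteq> 0" using assms(1) by simp
  ultimately have "g = - ?g'" using mult_left_cancel by blast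
  moreover have "subst (X(i := X j)) ?g' = subst (X(i := X j)) g"
    unfolding subst_subst by (intro arg_cong[of _ _ "\<lambda>s. subst s g"]) (auto simp: transpose_def)
  ultimately have "subst (X(i := X j)) g = - subst (X(i := X j)) g" by (metis subst_uminus)
  then have "2 * subst (X(i := X j)) g = 0" by (simp add: eq_neg_iff_add_eq_0)
  then have "X i - X j dvd g" by (simp add: *)
  then show ?thesis using g by (simp add: power2_eq_square mult_dvd_mono)
qed

text \<open>\<open>X i - X j\<close> for \<open>i < j\<close> are pairwise non-associated primes.\<close>

lemma Disc_mult_power_dvd:
  assumes S: "finite S" "z \<notin> S"
    and "\<And>i j. i \<in> S \<Longrightarrow> j \<in> S \<Longrightarrow> i \<noteq> j \<Longrightarrow> (X i - X j) ^ 2 dvd f"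
    and "\<And>l. l \<in> S \<Longrightarrow> (X z - X l) ^ m dvd f"
  shows "Disc S * (\<Prod>l\<in>S. X z - X l) ^ m dvd f"
proof -
  let ?L = "{(i,j). i \<in> S \<and> j \<in> S \<and> i < j}" and ?Z = "Pair z ` S"
  define q where "q = (\<lambda>(i,j). X i - X j)"
  \<comment> \<open>Since \<open>z\<close> is not in \<open>S\<close>, the first component tells the
    pairs with \<open>z\<close>, of exponent \<open>m\<close>, from the pairs inside
    \<open>S\<close>, of exponent 2.\<close>
  define e where "e p = (if fst p = z then m else (2::nat))" for p :: "nat \<times> nat"
  have fin: "finite ?L" by (rule finite_subset[of _ "S \<times> S"]) (use S in auto)
  have not_dvd: "\<not> q p dvd q r" if "p \<in> ?L \<union> ?Z" "r \<in> ?L \<union> ?Z" "p \<noteq> r" for p r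
  proof -
    obtain i j k l where [simp]: "p = (i, j)" "r = (k, l)" by (metis surj_pair)
    have "i \<noteq> j" using that S by auto
    then have "X i - X j dvd X k - X l \<longleftrightarrow> subst (X(i := X j)) (X k - X l) = 0"
      by (intro X_minus_dvd_iff Pol_X) auto
    then show ?thesis using that S by (auto simp: q_def)
  qed
  have "(\<Prod>p\<in>?L \<union> ?Z. q p ^ e p) dvd f"
  proof (rule prod_prime_elem_power_dvd[OF _ _ _ not_dvd])
    show "finite (?L \<union> ?Z)" using fin S by simp
    show "prime_elem (q p)" if "p \<in> ?L \<union> ?Z" for p
      using that S by (auto simp: q_def intro!: prime_elem_diff)
    show "q p ^ e p dvd f" if "p \<in> ?L \<union> ?Z" for p
      using that S assms(3,4) by (auto simp: q_def e_def)
  qed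
  also have "(\<Prod>p\<in>?L \<union> ?Z. q p ^ e p) = (\<Prod>p\<in>?L. q p ^ e p) * (\<Prod>p\<in>?Z. q p ^ e p)"
    using fin S by (intro prod.union_disjoint) auto
  also have "(\<Prod>p\<in>?L. q p ^ e p) = (\<Prod>(i,j)\<in>?L. (X i - X j) ^ 2)"
    using S by (intro prod.cong) (auto simp: q_def e_def)
  also have "(\<Prod>p\<in>?Z. q p ^ e p) = (\<Prod>l\<in>S. X z - X l) ^ m"
    by (simp add: prod.reindex inj_on_def q_def e_def prod_power_distrib)
  finally show ?thesis using Disc_dvd[OF S(1)] by (meson dvd_trans mult_dvd_mono dvd_refl)
qed

subsection \<open>Collapsing variables and lifting back\<close>

lemma sym_polys_eq_Sym: "sym_polys n = Sym {1..n} {1..n}"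
  by (simp add: sym_polys_def Sym_def polys_eq_Pol)

definition collapse :: "nat \<Rightarrow> nat \<Rightarrow> cpoly" where
  "collapse m i = (if i \<in> {1..m} then X 1 else X i)"

text \<open>Up to sign this is the polynomial called \<open>D\<^sub>m\<close> in the opening
  overview, with \<open>X 1\<close> as the repeated variable.\<close>

definition collapse_factor :: "nat \<Rightarrow> nat \<Rightarrow> cpoly" where
  "collapse_factor n m = Disc {m<..n} * (\<Prod>l\<in>{m<..n}. X 1 - X l) ^ m"

lemma homogeneous_collapse_factor: "homogeneous ((n - m) * (n - m - 1) + m * (n - m)) (collapse_factor n m)"
proof -
  have "homogeneous (\<Sum>l\<in>{m<..n}. 1) (\<Prod>l\<in>{m<..n}. X 1 - X l)"
    by (intro homogeneous_prod homogeneous_diff_X)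
  then have "homogeneous (m * (n - m)) ((\<Prod>l\<in>{m<..n}. X 1 - X l) ^ m)"
    by (intro homogeneous_power) simp
  moreover have "homogeneous ((n - m) * (n - m - 1)) (Disc {m<..n})"
    using homogeneous_Disc[of "{m<..n}"] by simp
  ultimately show ?thesis unfolding collapse_factor_def by (rule homogeneous_mult[rotated])
qed

lemma collapse_factor_nonzero: "1 \<le> m \<Longrightarrow> collapse_factor n m \<noteq> 0"
  by (auto simp: collapse_factor_def)

lemma collapse_factor_Sym:
  assumes "1 \<le> m"
  shows "collapse_factor n m \<in> Sym {m<..n} (insert 1 {m<..n})"
proof -
  have "collapse_factor n m \<in> Pol (insert 1 {m<..n})"
    unfolding collapse_factor_def by (intro Pol_mult Pol_power Pol_prod Pol_diff Pol_X Disc_Pol) auto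
  moreover have "subst (\<lambda>i. X (\<sigma> i)) (collapse_factor n m) = collapse_factor n m" if \<sigma>: "\<sigma> permutes {m<..n}" for \<sigma>
  proof -
    have "\<sigma> 1 = 1" using \<sigma> assms by (auto simp: permutes_not_in)
    moreover have "(\<Prod>l\<in>{m<..n}. X 1 - X (\<sigma> l)) = (\<Prod>l\<in>{m<..n}. X 1 - X l)"
      using prod.permute[OF \<sigma>, of "\<lambda>l. X 1 - X l"] by (simp add: comp_def)
    ultimately show ?thesis
      using subst_Disc[OF permutes_inj_on[OF \<sigma>], of "{m<..n}"] permutes_image[OF \<sigma>] by (simp add: collapse_factor_def)
  qed
  ultimately show ?thesis by (simp add: Sym_def)
qed

text \<open>A permutation of the tail \<open>{m<..n}\<close> fixes \<open>{1..m}\<close> pointwise,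
  hence commutes with the collapse.\<close>

lemma subst_collapse_Sym:
  assumes f: "f \<in> sym_polys n" and m: "1 \<le> m" "m \<le> n"
  shows "subst (collapse m) f \<in> Sym {m<..n} (insert 1 {m<..n})"
proof -
  have "subst (collapse m) f \<in> Pol (insert 1 {m<..n})"
    using f by (intro Pol_subst[of f "{1..n}"]) (auto simp: sym_polys_eq_Sym Sym_def collapse_def intro: Pol_X)
  moreover have "subst (\<lambda>i. X (\<sigma> i)) (subst (collapse m) f) = subst (collapse m) f"
    if \<sigma>: "\<sigma> permutes {m<..n}" for \<sigma>
  proof -
    have "\<sigma> permutes {1..n}" using \<sigma> by (rule permutes_subset) auto
    then have "subst (collapse m) f = subst (collapse m) (subst (\<lambda>i. X (\<sigma> i)) f)"
      using f by (simp add: sym_polys_eq_Sym Sym_def)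
    also have "\<dots> = subst (\<lambda>i. X (\<sigma> i)) (subst (collapse m) f)"
    proof -
      have "collapse m (\<sigma> i) = subst (\<lambda>i. X (\<sigma> i)) (collapse m i)" for i
      proof (cases "i \<in> {m<..n}")
        case True
        then have "\<sigma> i \<in> {m<..n}" using permutes_in_image[OF \<sigma>] by blast
        then show ?thesis using True by (auto simp: collapse_def)
      next
        case False
        then have "\<sigma> i = i" "\<sigma> 1 = 1" using \<sigma> m by (auto simp: permutes_not_in)
        then show ?thesis by (simp add: collapse_def)
      qed
      then show ?thesis by (simp add: subst_subst)
    qed
    finally show ?thesis by simp
  qed
  ultimately show ?thesis by (simp add: Sym_def)
qed

section \<open>Lifting by symmetrisation\<close>

definition Cross :: "nat set \<Rightarrow> nat set \<Rightarrow> cpoly" where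
  "Cross S T = (\<Prod>i\<in>S. \<Prod>j\<in>T. X i - X j)"

lemma subst_Cross:
  assumes "inj_on \<pi> S" "inj_on \<pi> T"
  shows "subst (\<lambda>i. X (\<pi> i)) (Cross S T) = Cross (\<pi> ` S) (\<pi> ` T)"
  unfolding Cross_def using assms by (simp add: prod.reindex)

text \<open>The average of the first \<open>m\<close> variables is symmetric in them, has degree 1,
  and becomes \<open>X 1\<close> again after the collapse.\<close>

definition mean :: "nat \<Rightarrow> nat \<Rightarrow> cpoly" where
  "mean m = X(1 := const (1 / of_nat m) * (\<Sum>i\<in>{1..m}. X i))"

text \<open>A product that vanishes as soon as a variable of the tail is identified with any other
  variable, and that collapses to \<open>collapse_factor n m\<close>.\<close>

definition seed :: "nat \<Rightarrow> nat \<Rightarrow> cpoly" where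
  "seed n m = Disc {m<..n} * Cross {1..m} {m<..n}"

text \<open>Once \<open>X 1 = \<dots> = X m\<close>, only the summands with \<open>\<pi>\<close> preserving \<open>{1..m}\<close> survive, and these all
  become \<open>collapse_factor n m * a\<close>.\<close>

definition sym_lift :: "nat \<Rightarrow> nat \<Rightarrow> cpoly \<Rightarrow> cpoly" where
  "sym_lift n m a = (\<Sum>\<pi> | \<pi> permutes {1..n}. subst (\<lambda>i. X (\<pi> i)) (seed n m * subst (mean m) a))"

lemma linear_sym_lift: "Vector_Spaces.linear scale scale (sym_lift n m)"
  by (rule linear_scaleI) (auto simp: sym_lift_def ring_distribs sum.distrib sum_distrib_left mult_ac)

lemma subst_seed:
  assumes "\<pi> permutes {1..n}" "m \<le> n"
  shows "subst (\<lambda>i. X (\<pi> i)) (seed n m) = Disc (\<pi> ` {m<..n}) * Cross (\<pi> ` {1..m}) (\<pi> ` {m<..n})"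
  unfolding seed_def using permutes_inj_on[OF assms(1)] by (simp add: subst_Disc subst_Cross)

text \<open>The index \<open>i\<close> lies in the permuted tail, so \<open>X j - X i\<close> is a
  factor: of \<open>Cross\<close> if \<open>j\<close> lies in the permuted head, of
  \<open>Disc\<close> if it lies in the tail too.\<close>

lemma subst_seed_eq_0:
  assumes \<pi>: "\<pi> permutes {1..n}" and "m \<le> n" and ij: "i \<in> {1..n}" "j \<in> {1..n}" "i \<noteq> j" "s i = s j"
    and i: "i \<in> \<pi> ` {m<..n}"
  shows "subst s (subst (\<lambda>i. X (\<pi> i)) (seed n m)) = 0"
proof -
  have "{1..n} = {1..m} \<union> {m<..n}" using \<open>m \<le> n\<close> by auto
  then have "\<pi> ` {1..m} \<union> \<pi> ` {m<..n} = {1..n}" using permutes_image[OF \<pi>] by (metis image_Un)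
  then consider "j \<in> \<pi> ` {1..m}" | "j \<in> \<pi> ` {m<..n}" using ij by blast
  then show ?thesis
  proof cases
    case 1
    have "subst s (Cross (\<pi> ` {1..m}) (\<pi> ` {m<..n})) = 0"
      unfolding Cross_def subst_prod subst_diff subst_X
      by (rule prod_zero, simp, rule bexI[of _ j], rule prod_zero, simp, rule bexI[of _ i]) (use i ij 1 in auto)
    then show ?thesis by (simp add: subst_seed[OF \<pi> \<open>m \<le> n\<close>])
  next
    case 2
    have "subst s (Disc (\<pi> ` {m<..n})) = 0"
      unfolding Disc_def subst_prod subst_diff subst_X
      by (rule prod_zero, simp, rule bexI[of _ j], rule prod_zero, simp, rule bexI[of _ i]) (use i ij 2 in auto)
    then show ?thesis by (simp add: subst_seed[OF \<pi> \<open>m \<le> n\<close>])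
  qed
qed

lemma sym_lift_sym_polys:
  assumes "a \<in> Pol (insert 1 {m<..n})" "1 \<le> m" "m \<le> n"
  shows "sym_lift n m a \<in> sym_polys n"
proof -
  have mean: "mean m i \<in> Pol {1..n}" if "i \<in> {1..n}" for i
    using that assms by (auto simp: mean_def intro!: Pol_mult Pol_sum Pol_X)
  have "seed n m * subst (mean m) a \<in> Pol {1..n}"
    unfolding seed_def Cross_def using assms
    by (intro Pol_mult Pol_prod Pol_diff Pol_X Disc_Pol Pol_subst[OF assms(1)] mean) auto
  then have "sym_lift n m a \<in> Pol {1..n}"
    unfolding sym_lift_def
  proof (intro Pol_sum Pol_subst[of _ "{1..n}"] Pol_X)
    fix \<pi> i assume "\<pi> \<in> {\<pi>. \<pi> permutes {1..n}}" "i \<in> {1..n}"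
    then show "\<pi> i \<in> {1..n}" using permutes_in_image[of \<pi> "{1..n}" i] by blast
  qed
  moreover have "subst (\<lambda>i. X (\<sigma> i)) (sym_lift n m a) = sym_lift n m a" if "\<sigma> permutes {1..n}" for \<sigma>
    unfolding sym_lift_def
    \<comment> \<open>Composing with \<open>\<sigma>\<close> on the left only reindexes the sum over
      all permutations.\<close>
    by (subst (2) setum_permutations_compose_left[OF that]) (simp add: subst_subst comp_def)
  ultimately show ?thesis by (simp add: sym_polys_eq_Sym Sym_def)
qed

text \<open>Such a \<open>\<pi>\<close> preserves the tail too and acts on it by a permutation under
  which \<open>a\<close> is invariant, while the permuted average collapses to
  \<open>X 1\<close>.\<close>

lemma subst_collapse_mean:
  assumes "a \<in> Sym {m<..n} (insert 1 {m<..n})" "1 \<le> m" "m \<le> n"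
    and \<pi>: "\<pi> permutes {1..n}" "\<pi> ` {1..m} = {1..m}"
  shows "subst (collapse m) (subst (\<lambda>i. X (\<pi> i)) (subst (mean m) a)) = a"
proof -
  have image: "\<pi> ` {m<..n} = {m<..n}"
  proof -
    have "{m<..n} = {1..n} - {1..m}" using assms(2) by auto
    then show ?thesis using \<pi> by (simp add: image_set_diff permutes_inj permutes_image)
  qed
  define \<tau> where "\<tau> i = (if i \<in> {m<..n} then \<pi> i else i)" for i
  have "\<tau> permutes {m<..n}"
  proof (rule bij_imp_permutes)
    have "bij_betw \<pi> {m<..n} {m<..n}" using image permutes_inj_on[OF \<pi>(1)] by (simp add: bij_betw_def)
    then show "bij_betw \<tau> {m<..n} {m<..n}" by (rule bij_betw_cong[THEN iffD1, rotated]) (simp add: \<tau>_def)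
  qed (auto simp: \<tau>_def)
  then have "a = subst (\<lambda>i. X (\<tau> i)) a" using assms(1) by (simp add: Sym_def)
  also have "\<dots> = subst (\<lambda>i. subst (collapse m) (subst (\<lambda>i. X (\<pi> i)) (mean m i))) a"
  proof (rule subst_cong)
    show "a \<in> Pol (insert 1 {m<..n})" using assms(1) by (rule Sym_Pol)
    fix i assume i: "i \<in> insert 1 {m<..n}"
    show "X (\<tau> i) = subst (collapse m) (subst (\<lambda>i. X (\<pi> i)) (mean m i))"
    proof (cases "i = 1")
      case True
      have "(\<Sum>k\<in>{1..m}. collapse m (\<pi> k)) = (\<Sum>k\<in>{1..m}. X 1)"
        using \<pi>(2) by (intro sum.cong) (auto simp: collapse_def)
      then have "subst (collapse m) (subst (\<lambda>i. X (\<pi> i)) (mean m 1)) = const (1 / of_nat m) * (of_nat m * X 1)"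
        by (simp add: mean_def)
      also have "\<dots> = const (1 / of_nat m * of_nat m) * X 1"
        by (simp only: const_mult const_of_nat mult.assoc)
      also have "\<dots> = X 1" using assms(2) by simp
      finally show ?thesis using True assms(2) by (simp add: \<tau>_def)
    next
      case False
      then have "i \<in> {m<..n}" using i by auto
      then have "\<pi> i \<in> {m<..n}" using image by blast
      then show ?thesis using False \<open>i \<in> {m<..n}\<close> by (auto simp: \<tau>_def mean_def collapse_def)
    qed
  qed
  finally show ?thesis by (simp add: subst_subst)
qed

text \<open>The constant is the number of permutations preserving \<open>{1..m}\<close>. It does not
  depend on \<open>a\<close>, and it is nonzero because the identity is counted.\<close>

lemma collapse_sym_lift:
  assumes "2 \<le> m" "m \<le> n"
  shows "\<exists>c. c \<noteq> 0 \<and> (\<forall>a\<in>Sym {m<..n} (insert 1 {m<..n}).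
    subst (collapse m) (sym_lift n m a) = const c * (collapse_factor n m * a))"
proof -
  let ?G = "{\<pi>. \<pi> permutes {1..n} \<and> \<pi> ` {1..m} = {1..m}}"
  have fin: "finite {\<pi>. \<pi> permutes {1..n}}" by (rule finite_permutations) simp
  then have finG: "finite ?G" by (rule rev_finite_subset) auto
  have "id \<in> ?G" by (simp add: permutes_id)
  then have "card ?G \<noteq> 0" using card_0_eq[OF finG] by blast
  moreover have "subst (collapse m) (sym_lift n m a) = const (of_nat (card ?G)) * (collapse_factor n m * a)"
    if a: "a \<in> Sym {m<..n} (insert 1 {m<..n})" for a
  proof -
    have "subst (collapse m) (sym_lift n m a) = (\<Sum>\<pi> | \<pi> permutes {1..n}.
        subst (collapse m) (subst (\<lambda>i. X (\<pi> i)) (seed n m)) * subst (collapse m) (subst (\<lambda>i. X (\<pi> i)) (subst (mean m) a)))"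
      by (simp add: sym_lift_def)
    also have "\<dots> = (\<Sum>\<pi>\<in>?G.
        subst (collapse m) (subst (\<lambda>i. X (\<pi> i)) (seed n m)) * subst (collapse m) (subst (\<lambda>i. X (\<pi> i)) (subst (mean m) a)))"
    proof (rule sum.mono_neutral_right[OF fin])
      show "\<forall>\<pi>\<in>{\<pi>. \<pi> permutes {1..n}} - ?G.
          subst (collapse m) (subst (\<lambda>i. X (\<pi> i)) (seed n m)) * subst (collapse m) (subst (\<lambda>i. X (\<pi> i)) (subst (mean m) a)) = 0"
      proof
        fix \<pi> assume "\<pi> \<in> {\<pi>. \<pi> permutes {1..n}} - ?G"
        then have \<pi>: "\<pi> permutes {1..n}" "\<pi> ` {1..m} \<noteq> {1..m}" by auto
        have "\<not> {1..m} \<subseteq> \<pi> ` {1..m}"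
        proof
          assume "{1..m} \<subseteq> \<pi> ` {1..m}"
          then have "{1..m} = \<pi> ` {1..m}"
            using permutes_inj_on[OF \<pi>(1)] by (intro card_subset_eq) (auto simp: card_image)
          then show False using \<pi>(2) by simp
        qed
        then obtain i where i: "i \<in> {1..m}" "i \<notin> \<pi> ` {1..m}" by blast
        have "{1..n} = {1..m} \<union> {m<..n}" using \<open>m \<le> n\<close> by auto
        then have "\<pi> ` {1..m} \<union> \<pi> ` {m<..n} = {1..n}" using permutes_image[OF \<pi>(1)] by (metis image_Un)
        then have "i \<in> \<pi> ` {m<..n}" using i assms by auto
        \<comment> \<open>A second index of \<open>{1..m}\<close>, which the collapse identifies
          with \<open>i\<close>; it exists because \<open>m\<close> is at least 2.\<close>
        moreover define j where "j = (if i = 1 then 2 else 1 :: nat)"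
        moreover have "j \<in> {1..m}" "i \<noteq> j" using assms(1) by (auto simp: j_def)
        ultimately have "subst (collapse m) (subst (\<lambda>i. X (\<pi> i)) (seed n m)) = 0"
          using i assms by (intro subst_seed_eq_0[OF \<pi>(1), of m i j]) (auto simp: collapse_def)
        then show "subst (collapse m) (subst (\<lambda>i. X (\<pi> i)) (seed n m)) * subst (collapse m) (subst (\<lambda>i. X (\<pi> i)) (subst (mean m) a)) = 0"
          by simp
      qed
    qed auto
    also have "\<dots> = (\<Sum>\<pi>\<in>?G. collapse_factor n m * a)"
    proof (rule sum.cong[OF refl])
      fix \<pi> assume "\<pi> \<in> ?G"
      then have \<pi>: "\<pi> permutes {1..n}" "\<pi> ` {1..m} = {1..m}" by auto
      have image: "\<pi> ` {m<..n} = {m<..n}"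
      proof -
        have "{m<..n} = {1..n} - {1..m}" using assms(1) by auto
        then show ?thesis using \<pi> by (simp add: image_set_diff permutes_inj permutes_image)
      qed
      have "subst (collapse m) (Disc {m<..n}) = Disc {m<..n}"
        using subst_cong[OF Disc_Pol[OF subset_refl], of "{m<..n}" "collapse m" X] by (auto simp: collapse_def)
      moreover have "subst (collapse m) (Cross {1..m} {m<..n}) = (\<Prod>l\<in>{m<..n}. X 1 - X l) ^ m"
        by (simp add: Cross_def collapse_def)
      ultimately have "subst (collapse m) (subst (\<lambda>i. X (\<pi> i)) (seed n m)) = collapse_factor n m"
        using image \<pi>(2) by (simp add: subst_seed[OF \<pi>(1) assms(2)] collapse_factor_def)
      then show "subst (collapse m) (subst (\<lambda>i. X (\<pi> i)) (seed n m)) * subst (collapse m) (subst (\<lambda>i. X (\<pi> i)) (subst (mean m) a)) = collapse_factor n m * a"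
        using subst_collapse_mean[OF a _ assms(2) \<pi>] assms(1) by simp
    qed
    also have "\<dots> = const (of_nat (card ?G)) * (collapse_factor n m * a)" by (simp add: const_of_nat)
    finally show ?thesis .
  qed
  ultimately show ?thesis by (intro exI[of _ "of_nat (card ?G)"]) auto
qed

text \<open>The seed has the same degree as \<open>collapse_factor n m\<close>, and neither
  \<open>mean\<close> nor a permutation changes the degree of \<open>a\<close>.\<close>

lemma homogeneous_sym_lift:
  assumes "homogeneous d (collapse_factor n m * a)" "1 \<le> m" "m \<le> n"
  shows "homogeneous d (sym_lift n m a)"
proof (cases "a = 0")
  case True
  then show ?thesis by (simp add: sym_lift_def)
next
  case False
  let ?e = "(n - m) * (n - m - 1) + m * (n - m)"
  have "?e \<le> d"
    using homogeneous_mult_less_eq_0[OF assms(1) homogeneous_collapse_factor] False collapse_factor_nonzero[OF assms(2)] by force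
  then have a: "homogeneous (d - ?e) a"
    using homogeneous_quotient[of ?e "d - ?e" "collapse_factor n m" a] assms homogeneous_collapse_factor collapse_factor_nonzero by simp
  have "homogeneous (\<Sum>i\<in>{1..m}. \<Sum>j\<in>{m<..n}. 1) (Cross {1..m} {m<..n})"
    unfolding Cross_def by (intro homogeneous_prod homogeneous_diff_X)
  then have seed: "homogeneous ?e (seed n m)"
    unfolding seed_def using homogeneous_Disc[of "{m<..n}"] by (intro homogeneous_mult) auto
  have "homogeneous 1 (mean m i)" for i
    using homogeneous_X unfolding mean_def by (auto intro!: homogeneous_const_mult homogeneous_sum)
  then have "homogeneous (?e + (d - ?e)) (seed n m * subst (mean m) a)"
    using a seed by (intro homogeneous_mult homogeneous_subst)
  then have "homogeneous d (seed n m * subst (mean m) a)" using \<open>?e \<le> d\<close> by simp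
  then show ?thesis unfolding sym_lift_def
    by (intro homogeneous_sum homogeneous_subst homogeneous_X)
qed

lemma shift_subspace: "cpoly.subspace {a \<in> Sym S V. homogeneous d (D * a)}"
proof (rule subspaceI)
  fix c f assume "f \<in> {a \<in> Sym S V. homogeneous d (D * a)}"
  then show "const c * f \<in> {a \<in> Sym S V. homogeneous d (D * a)}"
    using homogeneous_const_mult[of d "D * f" c] by (simp add: Sym_mult mult.left_commute[of D])
qed (auto simp: ring_distribs intro: Sym_add homogeneous_add)

lemma shift_finite_span:
  assumes "homogeneous e D" "D \<noteq> 0" "finite V"
  obtains U where "finite U" "{a \<in> Sym S V. homogeneous d (D * a)} \<subseteq> cpoly.span U"
proof -
  obtain U where U: "finite U" "{f \<in> Sym S V. homogeneous (d - e) f} \<subseteq> cpoly.span U"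
    using Sym_finite_span[OF assms(3)] .
  have "homogeneous (d - e) a" if "homogeneous d (D * a)" for a
  proof (cases "e \<le> d")
    case True
    then show ?thesis using homogeneous_quotient[of e "d - e" D a] assms that by simp
  next
    case False
    then show ?thesis using homogeneous_mult_less_eq_0[OF that assms(1)] assms by simp
  qed
  then show ?thesis using that U by blast
qed

text \<open>One step of the filtration: \<open>dim_split\<close> for the collapse, with
  \<open>sym_lift\<close> as the lift and multiplication by a constant multiple of
  \<open>collapse_factor n m\<close> as the embedding. \<open>upper\<close> bounds the image and
  \<open>lower\<close> makes it full.\<close>

lemma dim_stage:
  assumes m: "2 \<le> m" "m \<le> n"
    and V: "cpoly.subspace V" "V \<subseteq> {f \<in> sym_polys n. homogeneous d f}"
    and upper: "\<And>f. f \<in> V \<Longrightarrow> collapse_factor n m dvd subst (collapse m) f"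
    and lower: "\<And>a. a \<in> Sym {m<..n} (insert 1 {m<..n}) \<Longrightarrow> homogeneous d (sym_lift n m a) \<Longrightarrow> sym_lift n m a \<in> V"
  shows "cpoly.dim V = cpoly.dim {a \<in> Sym {m<..n} (insert 1 {m<..n}). homogeneous d (collapse_factor n m * a)} +
    cpoly.dim {f \<in> V. subst (collapse m) f = 0}"
proof -
  have m1: "1 \<le> m" using m by simp
  let ?A = "{a \<in> Sym {m<..n} (insert 1 {m<..n}). homogeneous d (collapse_factor n m * a)}"
  obtain c where c: "c \<noteq> 0" "\<And>a. a \<in> Sym {m<..n} (insert 1 {m<..n}) \<Longrightarrow>
      subst (collapse m) (sym_lift n m a) = const c * (collapse_factor n m * a)"
    using collapse_sym_lift[OF m] by blast
  obtain U where U: "finite U" "?A \<subseteq> cpoly.span U"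
    using shift_finite_span[OF homogeneous_collapse_factor collapse_factor_nonzero[OF m1], of "insert 1 {m<..n}"] by blast
  obtain W where W: "finite W" "{f \<in> sym_polys n. homogeneous d f} \<subseteq> cpoly.span W"
    using Sym_finite_span[of "{1..n}"] unfolding sym_polys_eq_Sym by blast
  have VW: "V \<subseteq> cpoly.span W" using V(2) W(2) by blast
  have nz: "const c * collapse_factor n m \<noteq> 0" using c collapse_factor_nonzero[OF m1] by simp
  show ?thesis
  proof (rule dim_split[OF linear_subst linear_sym_lift linear_mult inj_mult[OF nz] V(1) W(1) VW shift_subspace U])
    fix a assume a: "a \<in> ?A"
    then show "sym_lift n m a \<in> V" using lower homogeneous_sym_lift[OF _ m1 m(2)] by simp
    show "subst (collapse m) (sym_lift n m a) = const c * collapse_factor n m * a" using a c(2) by (simp add: mult.assoc)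
  next
    fix f assume f: "f \<in> V"
    then obtain a where a: "subst (collapse m) f = collapse_factor n m * a" using upper by blast
    have fs: "f \<in> sym_polys n" "homogeneous d f" using f V(2) by auto
    have "a \<in> Sym {m<..n} (insert 1 {m<..n})"
      using subst_collapse_Sym[OF fs(1) m1 m(2)] collapse_factor_Sym[OF m1] collapse_factor_nonzero[OF m1] Sym_quotient
      unfolding a by blast
    moreover have "homogeneous d (collapse_factor n m * a)"
      unfolding a[symmetric] by (rule homogeneous_subst[OF fs(2)]) (simp add: collapse_def homogeneous_X[simplified])
    \<comment> \<open>Dividing by \<open>c\<close> compensates the constant that the lift
      introduces.\<close>
    ultimately have "const (1 / c) * a \<in> ?A"
      by (simp add: Sym_mult homogeneous_const_mult mult.left_commute[of _ "const (1 / c)"])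
    moreover have "const c * collapse_factor n m * (const (1 / c) * a) = const (c * (1 / c)) * (collapse_factor n m * a)"
      by (simp only: const_mult mult_ac)
    then have "subst (collapse m) f = const c * collapse_factor n m * (const (1 / c) * a)" using a c(1) by simp
    ultimately show "subst (collapse m) f \<in> (*) (const c * collapse_factor n m) ` ?A" by blast
  qed
qed

subsection \<open>Vanishing orders of elements of the ideal\<close>

text \<open>The value at a new point \<open>a\<close> is corrected by the transposition of
  \<open>\<pi> a\<close> and \<open>g a\<close>. Injectivity keeps the values already prescribed
  away from both.\<close>

lemma permutes_extend:
  assumes "finite T" "inj_on g T" "T \<subseteq> S" "g ` T \<subseteq> S"
  shows "\<exists>\<pi>. \<pi> permutes S \<and> (\<forall>x\<in>T. \<pi> x = g x)"
  using assms
proof (induction T rule: finite_induct)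
  case empty
  then show ?case using permutes_id by blast
next
  case (insert a T)
  then obtain \<pi> where \<pi>: "\<pi> permutes S" "\<forall>x\<in>T. \<pi> x = g x" by auto
  let ?\<pi> = "transpose (\<pi> a) (g a) \<circ> \<pi>"
  have "?\<pi> permutes S"
    using \<pi>(1) insert.prems permutes_in_image[OF \<pi>(1)] by (intro permutes_compose permutes_swap_id) auto
  moreover have "?\<pi> x = g x" if "x \<in> insert a T" for x
  proof (cases "x = a")
    case False
    then have "x \<in> T" using that by simp
    have "\<pi> x \<noteq> \<pi> a" using False permutes_inj[OF \<pi>(1)] by (simp add: inj_eq)
    moreover have "g x \<noteq> g a" using insert.prems(1) insert.hyps(2) \<open>x \<in> T\<close> by (auto simp: inj_on_def)
    ultimately show ?thesis using \<pi>(2) \<open>x \<in> T\<close> by (simp add: transpose_def)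
  qed simp
  ultimately show ?case by blast
qed

lemma subst_permuted:
  assumes "f \<in> sym_polys n" "\<pi> permutes {1..n}"
  shows "subst (\<lambda>i. v (\<pi> i)) f = subst v f"
  using assms subst_subst[of v "\<lambda>i. X (\<pi> i)" f] by (simp add: sym_polys_def)

lemma subst_collapse_2:
  assumes "v 2 = v 1"
  shows "subst v (subst (collapse 2) f) = subst v f"
proof -
  have "subst v (collapse 2 i) = v i" for i
    using assms by (cases "i = 1"; cases "i = 2") (auto simp: collapse_def)
  then show ?thesis by (simp add: subst_subst)
qed

text \<open>By symmetry the two coinciding pairs may be moved to the positions 1, 2 and 3, 4, where
  evaluation factors through \<open>pairs_collapsed\<close>.\<close>

lemma ideal_I_vanishes:
  assumes f: "f \<in> ideal_I n" and "4 \<le> n"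
    and "distinct [i, j, k, l]" "{i, j, k, l} \<subseteq> {1..n}" "v i = v j" "v k = v l"
  shows "subst v f = 0"
proof -
  define g where "g x = (if x = 1 then i else if x = 2 then j else if x = 3 then k else l)" for x :: nat
  have "\<exists>\<pi>. \<pi> permutes {1..n} \<and> (\<forall>x\<in>{1, 2, 3, 4}. \<pi> x = g x)"
    using assms by (intro permutes_extend) (auto simp: g_def inj_on_def)
  then obtain \<pi> where \<pi>: "\<pi> permutes {1..n}" "\<forall>x\<in>{1, 2, 3, 4}. \<pi> x = g x" by blast
  let ?v = "\<lambda>i. v (\<pi> i)"
  have "f \<in> sym_polys n" using f by (simp add: ideal_I_def)
  then have "subst v f = subst ?v f" using \<pi>(1) by (rule subst_permuted[symmetric])
  also have "\<dots> = subst (\<lambda>i. subst ?v (pairs_collapsed i)) f"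
    using \<pi>(2) assms(5,6) by (intro arg_cong[of _ _ "\<lambda>s. subst s f"]) (auto simp: pairs_collapsed_def g_def)
  also have "\<dots> = subst ?v (subst pairs_collapsed f)" by (simp add: subst_subst)
  also have "\<dots> = 0" using f by (simp add: ideal_I_def)
  finally show ?thesis .
qed

text \<open>The swap of \<open>a\<close> and \<open>b\<close> fixes \<open>g\<close> and
  \<open>X z\<close>, and carries one divisor to the other.\<close>

lemma transpose_image_dvd:
  assumes g: "g \<in> Sym S V" and "a \<in> S" "b \<in> S" "z \<notin> S" and dvd: "(X z - X a) ^ k dvd g"
  shows "(X z - X b) ^ k dvd g"
proof -
  let ?t = "\<lambda>i. X (transpose a b i)"
  obtain h where "g = (X z - X a) ^ k * h" using dvd ..
  moreover have "subst ?t g = g" using g permutes_swap_id[OF assms(2,3)] by (simp add: Sym_def)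
  moreover have "transpose a b z = z" using assms by (auto simp: transpose_def)
  then have "subst ?t ((X z - X a) ^ k * h) = (X z - X b) ^ k * subst ?t h" by simp
  ultimately have "g = (X z - X b) ^ k * subst ?t h" by simp
  then show ?thesis by simp
qed

section \<open>Zeros of higher order on the collapsed diagonals\<close>

definition mid :: "(nat \<Rightarrow> cpoly) \<Rightarrow> cpoly" where "mid v = const (1/2) * (v 1 + v 2)"

lemma mid_half: "const (1/2) * (2 * f) = f"
proof -
  have "const (1/2) * (2 * f) = const (1/2 * 2) * f" by (simp only: const_mult const_numeral mult.assoc)
  then show ?thesis by simp
qed

text \<open>The difference between \<open>f\<close> and its value with both first arguments at their
  midpoint is symmetric in these arguments and vanishes when they agree, so
  \<open>square_dvd\<close> applies. One \<open>A\<close> serves all \<open>v\<close>, giving an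
  expansion without a linear term.\<close>

lemma midpoint_expansion:
  assumes f: "f \<in> sym_polys n" and n: "2 \<le> n"
  obtains A where "\<And>v. subst v f = (v 1 - v 2) ^ 2 * subst v A + subst (v(1 := mid v, 2 := mid v)) f"
proof -
  let ?h = "X(1 := mid X, 2 := mid X)"
  have sub: "subst v (?h i) = (v(1 := mid v, 2 := mid v)) i" for v i by (simp add: mid_def)
  let ?D = "f - subst ?h f"
  have "(X 1 - X 2) ^ 2 dvd ?D"
  proof (rule square_dvd)
    have "transpose 1 2 permutes {1..n}" using n by (intro permutes_swap_id) auto
    then have "subst (\<lambda>k. X (transpose 1 2 k)) f = f" using f by (simp add: sym_polys_def)
    moreover have "subst (\<lambda>k. X (transpose 1 2 k)) (subst ?h f) = subst ?h f"
      unfolding subst_subst sub by (intro arg_cong[of _ _ "\<lambda>s. subst s f"]) (auto simp: mid_def transpose_def add.commute)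
    ultimately show "subst (\<lambda>k. X (transpose 1 2 k)) ?D = ?D" by simp
    have "subst (X(1 := X 2)) (subst ?h f) = subst (X(1 := X 2)) f"
      unfolding subst_subst sub
      by (intro arg_cong[of _ _ "\<lambda>s. subst s f"]) (auto simp: mid_def mid_half mult_2[symmetric])
    then show "subst (X(1 := X 2)) ?D = 0" by simp
  qed simp
  then obtain A where A: "?D = (X 1 - X 2) ^ 2 * A" ..
  have "subst v f = (v 1 - v 2) ^ 2 * subst v A + subst (v(1 := mid v, 2 := mid v)) f" for v
  proof -
    have "subst v ?D = (v 1 - v 2) ^ 2 * subst v A" unfolding A by simp
    moreover have "subst v (subst ?h f) = subst (v(1 := mid v, 2 := mid v)) f" by (simp only: subst_subst sub)
    ultimately show ?thesis by (simp add: algebra_simps)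
  qed
  then show ?thesis by (rule that)
qed

text \<open>Compare \<open>f\<close> at \<open>(s, s, s + t)\<close> and at \<open>(s, s + t, s)\<close> to first order in \<open>t = X 0\<close>.\<close>

lemma collapse_2_double_zero:
  assumes f: "f \<in> sym_polys n" and n: "3 \<le> n" and zero: "subst (collapse 3) f = 0"
  shows "(X 1 - X 3) ^ 2 dvd subst (collapse 2) f"
proof -
  let ?g = "subst (collapse 2) f"
  have "subst (X(3 := X 1)) ?g = subst (collapse 3) f"
    unfolding subst_subst by (intro arg_cong[of _ _ "\<lambda>s. subst s f"] ext) (auto simp: collapse_def)
  then have "X 3 - X 1 dvd ?g" using zero X_minus_dvd_iff[of "X 1" 3 ?g] by (simp add: Pol_X)
  then obtain r where r: "?g = (X 3 - X 1) * r" ..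
  have fr: "subst v f = (v 3 - v 1) * subst v r" if "v 2 = v 1" for v
  proof -
    have "subst v f = subst v ?g" using that by (rule subst_collapse_2[symmetric])
    then show ?thesis unfolding r by simp
  qed
  obtain A where A: "\<And>v. subst v f = (v 1 - v 2) ^ 2 * subst v A + subst (v(1 := mid v, 2 := mid v)) f"
    using midpoint_expansion[OF f] n by auto
  define v where "v = X(2 := X 1, 3 := X 1 + X 0)"
  define w where "w = X(2 := X 1 + X 0, 3 := X 1)"
  let ?w = "w(1 := mid w, 2 := mid w)" and ?z = "X(0 := 0)"
  define p where "p = X(0 := 0, 2 := X 1, 3 := X 1)"
  have mid_w: "mid w = X 1 + const (1/2) * X 0"
  proof -
    have "mid w = const (1/2) * (X 1 + (X 1 + X 0))" by (simp add: mid_def w_def)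
    also have "X 1 + (X 1 + X 0) = 2 * X 1 + X 0" by (simp only: mult_2 add.assoc)
    finally show ?thesis by (simp only: distrib_left mid_half)
  qed
  have "transpose 2 3 permutes {1..n}" using n by (intro permutes_swap_id) auto
  then have "subst (\<lambda>i. w (transpose 2 3 i)) f = subst w f" by (rule subst_permuted[OF f])
  moreover have "(\<lambda>i. w (transpose 2 3 i)) = v" by (auto simp: w_def v_def transpose_def)
  ultimately have "subst v f = subst w f" by simp
  moreover have "subst v f = X 0 * subst v r" using fr[of v] by (simp add: v_def)
  \<comment> \<open>At \<open>w\<close> the midpoint is \<open>s + t/2\<close> and the third
    argument is \<open>s\<close>, so the factor \<open>v 3 - v 1\<close> of \<open>fr\<close>
    becomes \<open>-t/2\<close>.\<close>
  moreover have "subst w f = X 0 * (X 0 * subst w A - const (1/2) * subst ?w r)"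
    unfolding A[of w] using fr[of ?w] by (simp add: mid_w) (simp add: w_def power2_eq_square algebra_simps)
  ultimately have "X 0 * subst v r = X 0 * (X 0 * subst w A - const (1/2) * subst ?w r)" by simp
  then have "subst v r = X 0 * subst w A - const (1/2) * subst ?w r" using X_neq_0 mult_left_cancel by blast
  then have "subst ?z (subst v r) = - (const (1/2) * subst ?z (subst ?w r))" by simp
  moreover have "subst ?z (subst v r) = subst p r"
    unfolding subst_subst by (intro arg_cong[of _ _ "\<lambda>s. subst s r"]) (auto simp: v_def p_def)
  moreover have "subst ?z (subst ?w r) = subst p r"
    unfolding subst_subst mid_w
    by (intro arg_cong[of _ _ "\<lambda>s. subst s r"] ext) (auto simp: w_def p_def)
  \<comment> \<open>At \<open>t = 0\<close> both arguments of \<open>r\<close> become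
    \<open>p\<close>, so \<open>r\<close> at \<open>p\<close> equals minus one half of
    itself.\<close>
  ultimately have "const (3/2) * subst p r = 0"
    using const_add[of 1 "1/2"] by (simp add: ring_distribs eq_neg_iff_add_eq_0)
  then have p0: "subst p r = 0" by simp
  \<comment> \<open>The quotient \<open>r\<close> may contain \<open>X 0\<close> or
    \<open>X 2\<close>. Specialising both leaves the collapse of \<open>f\<close> unchanged and
    gives a cofactor that becomes \<open>subst p r\<close> on \<open>X 3 = X 1\<close>.\<close>
  let ?u = "X(0 := 0, 2 := X 1)"
  have "?g = subst ?u f"
  proof (rule subst_cong)
    show "f \<in> Pol {1..n}" using f by (simp add: sym_polys_eq_Sym Sym_def)
  qed (auto simp: collapse_def)
  then have g: "?g = (X 3 - X 1) * subst ?u r" using fr[of ?u] by simp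
  have "subst (X(3 := X 1)) (subst ?u r) = subst p r"
    unfolding subst_subst by (intro arg_cong[of _ _ "\<lambda>s. subst s r"]) (auto simp: p_def)
  then have "X 3 - X 1 dvd subst ?u r" using p0 X_minus_dvd_iff[of "X 1" 3 "subst ?u r"] by (simp add: Pol_X)
  then have "(X 3 - X 1) ^ 2 dvd ?g" unfolding g by (simp add: power2_eq_square mult_dvd_mono)
  then show ?thesis by (simp add: power2_commute)
qed

text \<open>Compare \<open>f\<close> at \<open>s + t (1, 1, 0, 2)\<close>, \<open>s + t (0, 2, 1, 1)\<close> and \<open>s + t (0, 1, 1, 2)\<close> to second
  order in \<open>t = X 0\<close>.\<close>

lemma collapse_3_triple_zero:
  assumes fI: "f \<in> ideal_I n" and n: "4 \<le> n"
  shows "(X 1 - X 4) ^ 3 dvd subst (collapse 3) f"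
proof -
  let ?g = "subst (collapse 2) f"
  have f: "f \<in> sym_polys n" using fI by (simp add: ideal_I_def)
  have "(X 3 - X 4) ^ 2 dvd ?g"
  proof (rule square_dvd)
    have "?g \<in> Sym {2<..n} (insert 1 {2<..n})" using subst_collapse_Sym[OF f] n by simp
    moreover have "transpose 3 4 permutes {2<..n}" using n by (intro permutes_swap_id) auto
    ultimately show "subst (\<lambda>k. X (transpose 3 4 k)) ?g = ?g" by (simp add: Sym_def)
    have "subst (\<lambda>i. subst (X(3 := X 4)) (collapse 2 i)) f = 0"
      by (rule ideal_I_vanishes[OF fI n, of 1 2 3 4]) (use n in \<open>auto simp: collapse_def\<close>)
    then show "subst (X(3 := X 4)) ?g = 0" by (simp add: subst_subst)
  qed simp
  then obtain H where H: "?g = (X 3 - X 4) ^ 2 * H" ..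
  have fH: "subst v f = (v 3 - v 4) ^ 2 * subst v H" if "v 2 = v 1" for v
  proof -
    have "subst v f = subst v ?g" using that by (rule subst_collapse_2[symmetric])
    then show ?thesis unfolding H by simp
  qed
  obtain A where A: "\<And>v. subst v f = (v 1 - v 2) ^ 2 * subst v A + subst (v(1 := mid v, 2 := mid v)) f"
    using midpoint_expansion[OF f] n by auto
  define P where "P a b c d = X(1 := X 1 + a * X 0, 2 := X 1 + b * X 0, 3 := X 1 + c * X 0, 4 := X 1 + d * X 0)"
    for a b c d :: cpoly
  \<comment> \<open>The three offset vectors rearrange 0, 1, 1, 2, so the symmetric \<open>f\<close>
    has one common value at these points.\<close>
  let ?v = "P 1 1 0 2" and ?w = "P 0 2 1 1" and ?u = "P 0 1 1 2" and ?z = "X(0 := 0)"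
  let ?m = "\<lambda>v. v(1 := mid v, 2 := mid v)"
  define p where "p = X(0 := 0, 2 := X 1, 3 := X 1, 4 := X 1)"
  have t: "transpose i j permutes {1..n}" if "i \<in> {1..4}" "j \<in> {1..4}" for i j
    using that n by (intro permutes_swap_id) auto
  have "subst (\<lambda>i. ?v (transpose 1 3 i)) f = subst ?v f" by (rule subst_permuted[OF f t]) auto
  moreover have "(\<lambda>i. ?v (transpose 1 3 i)) = ?u" by (auto simp: P_def transpose_def)
  ultimately have vu: "subst ?u f = subst ?v f" by simp
  have "subst (\<lambda>i. ?v ((transpose 1 3 \<circ> transpose 2 4) i)) f = subst ?v f"
    by (rule subst_permuted[OF f permutes_compose[OF t t]]) auto
  moreover have "(\<lambda>i. ?v ((transpose 1 3 \<circ> transpose 2 4) i)) = ?w" by (auto simp: P_def transpose_def)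
  ultimately have vw: "subst ?w f = subst ?v f" by simp
  have fv: "subst ?v f = X 0 ^ 2 * (4 * subst ?v H)"
    using fH[of ?v] by (simp add: P_def power_mult_distrib mult_ac)
  \<comment> \<open>The midpoint of offsets 0 and 2 is 1; the third and fourth arguments coincide,
    so only the \<open>A\<close> term remains.\<close>
  have fw: "subst ?w f = X 0 ^ 2 * (4 * subst ?w A)"
    unfolding A[of ?w] using fH[of "?m ?w"] by (simp add: P_def power_mult_distrib mult_ac)
  have fu: "subst ?u f = X 0 ^ 2 * (subst ?u A + subst (?m ?u) H)"
    unfolding A[of ?u] using fH[of "?m ?u"] by (simp add: P_def) (simp add: power2_eq_square algebra_simps)
  have X2: "X 0 ^ 2 \<noteq> (0::cpoly)" by simp
  have "4 * subst ?v H = 4 * subst ?w A" "4 * subst ?v H = subst ?u A + subst (?m ?u) H"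
    using vu vw fv fw fu mult_left_cancel[OF X2] by metis+
  then have "subst ?z (4 * subst ?v H) = subst ?z (4 * subst ?w A)"
    "subst ?z (4 * subst ?v H) = subst ?z (subst ?u A + subst (?m ?u) H)" by simp_all
  moreover have "subst ?z (subst (P a b c d) r) = subst p r" for a b c d r
    unfolding subst_subst by (intro arg_cong[of _ _ "\<lambda>s. subst s r"]) (auto simp: P_def p_def)
  moreover have "subst ?z (subst (?m ?u) H) = subst p H"
    unfolding subst_subst
    by (intro arg_cong[of _ _ "\<lambda>s. subst s H"]) (auto simp: mid_def P_def p_def mid_half mult_2[symmetric])
  \<comment> \<open>At \<open>t = 0\<close> all points become \<open>p\<close>. The first equation
    gives \<open>A = H\<close> there, the second \<open>A = 3 H\<close>, hence
    \<open>2 H = 0\<close>.\<close>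
  ultimately have "4 * subst p H = 4 * subst p A" "4 * subst p H = subst p A + subst p H" by simp_all
  then have "2 * subst p H = 0" by simp
  then have p0: "subst p H = 0" by simp
  let ?x = "X(0 := 0, 2 := X 1, 3 := X 1)"
  have "subst (collapse 3) f = subst ?x f"
  proof (rule subst_cong)
    show "f \<in> Pol {1..n}" using f by (simp add: sym_polys_eq_Sym Sym_def)
  qed (auto simp: collapse_def)
  then have g: "subst (collapse 3) f = (X 1 - X 4) ^ 2 * subst ?x H" using fH[of ?x] by simp
  have "subst (X(4 := X 1)) (subst ?x H) = subst p H"
    unfolding subst_subst by (intro arg_cong[of _ _ "\<lambda>s. subst s H"]) (auto simp: p_def)
  then have "X 4 - X 1 dvd subst ?x H" using p0 X_minus_dvd_iff[of "X 1" 4 "subst ?x H"] by (simp add: Pol_X)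
  then have "X 1 - X 4 dvd subst ?x H" by (metis minus_diff_eq minus_dvd_iff)
  then have "(X 1 - X 4) ^ 2 * (X 1 - X 4) dvd subst (collapse 3) f" unfolding g by (intro mult_dvd_mono) auto
  then show ?thesis by (simp add: power3_eq_cube power2_eq_square)
qed

text \<open>Identifying two tail variables creates a second pair beside 1, 2, so the collapse
  vanishes, and doubly by symmetry. The triple zero along \<open>X 1 = X 4\<close> is carried to the
  other \<open>X l\<close> by swaps.\<close>

lemma ideal_I_collapse_3:
  assumes f: "f \<in> ideal_I n" and n: "4 \<le> n"
  shows "collapse_factor n 3 dvd subst (collapse 3) f"
proof -
  let ?u = "subst (collapse 3) f"
  have fs: "f \<in> sym_polys n" using f by (simp add: ideal_I_def)
  have u: "?u \<in> Sym {3<..n} (insert 1 {3<..n})" using subst_collapse_Sym[OF fs] n by simp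
  show ?thesis
    unfolding collapse_factor_def
  proof (rule Disc_mult_power_dvd)
    fix i j assume ij: "i \<in> {3<..n}" "j \<in> {3<..n}" "i \<noteq> j"
    show "(X i - X j) ^ 2 dvd ?u"
    proof (rule square_dvd[OF ij(3)])
      show "subst (\<lambda>k. X (transpose i j k)) ?u = ?u" using Sym_subst[OF u permutes_swap_id[OF ij(1,2)]] .
      have "subst (\<lambda>k. subst (X(i := X j)) (collapse 3 k)) f = 0"
        by (rule ideal_I_vanishes[OF f n, of 1 2 i j]) (use ij in \<open>auto simp: collapse_def\<close>)
      then show "subst (X(i := X j)) ?u = 0" by (simp add: subst_subst)
    qed
  next
    fix l assume "l \<in> {3<..n}"
    then show "(X 1 - X l) ^ 3 dvd ?u"
      using n by (intro transpose_image_dvd[OF u, of 4 l 1] collapse_3_triple_zero[OF f n]) auto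
  qed auto
qed

text \<open>As for three collapsed variables, with the double zero along \<open>X 1 = X 3\<close>
  now supplied by the vanishing of the threefold collapse.\<close>

lemma ideal_I_collapse_2:
  assumes f: "f \<in> ideal_I n" and n: "4 \<le> n" and zero: "subst (collapse 3) f = 0"
  shows "collapse_factor n 2 dvd subst (collapse 2) f"
proof -
  let ?g = "subst (collapse 2) f"
  have fs: "f \<in> sym_polys n" using f by (simp add: ideal_I_def)
  have g: "?g \<in> Sym {2<..n} (insert 1 {2<..n})" using subst_collapse_Sym[OF fs] n by simp
  show ?thesis
    unfolding collapse_factor_def
  proof (rule Disc_mult_power_dvd)
    fix i j assume ij: "i \<in> {2<..n}" "j \<in> {2<..n}" "i \<noteq> j"
    show "(X i - X j) ^ 2 dvd ?g"
    proof (rule square_dvd[OF ij(3)])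
      show "subst (\<lambda>k. X (transpose i j k)) ?g = ?g" using Sym_subst[OF g permutes_swap_id[OF ij(1,2)]] .
      have "subst (\<lambda>k. subst (X(i := X j)) (collapse 2 k)) f = 0"
        by (rule ideal_I_vanishes[OF f n, of 1 2 i j]) (use ij in \<open>auto simp: collapse_def\<close>)
      then show "subst (X(i := X j)) ?g = 0" by (simp add: subst_subst)
    qed
  next
    fix l assume "l \<in> {2<..n}"
    then show "(X 1 - X l) ^ 2 dvd ?g"
      using n by (intro transpose_image_dvd[OF g, of 3 l 1] collapse_2_double_zero[OF fs _ zero]) auto
  qed auto
qed

text \<open>Symmetry spreads vanishing on \<open>X 1 = X 2\<close> to every diagonal, where it has
  order two. Conversely, \<open>X 1 - X 2\<close> is a factor of \<open>Disc {1..n}\<close>.\<close>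

lemma collapse_2_eq_0_iff:
  assumes f: "f \<in> sym_polys n" and n: "2 \<le> n"
  shows "subst (collapse 2) f = 0 \<longleftrightarrow> Disc {1..n} dvd f"
proof
  assume "Disc {1..n} dvd f"
  moreover have "subst (collapse 2) (Disc {1..n}) = 0"
    unfolding Disc_def subst_prod subst_diff subst_X
    by (rule prod_zero, simp, rule bexI[of _ 1], rule prod_zero, simp, rule bexI[of _ 2])
      (use n in \<open>auto simp: collapse_def\<close>)
  ultimately show "subst (collapse 2) f = 0" by auto
next
  assume zero: "subst (collapse 2) f = 0"
  \<comment> \<open>The exponent 0 makes the second product trivial, and \<open>X 0\<close> is a
    variable outside \<open>{1..n}\<close>, as \<open>Disc_mult_power_dvd\<close> requires.\<close>
  have "Disc {1..n} * (\<Prod>l\<in>{1..n}. X 0 - X l) ^ 0 dvd f"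
  proof (rule Disc_mult_power_dvd)
    fix i j assume ij: "i \<in> {1..n}" "j \<in> {1..n}" "i \<noteq> j"
    define g where "g k = (if k = 1 then i else j)" for k :: nat
    have "\<exists>\<pi>. \<pi> permutes {1..n} \<and> (\<forall>x\<in>{1, 2}. \<pi> x = g x)"
      using ij n by (intro permutes_extend) (auto simp: g_def inj_on_def)
    then obtain \<pi> where \<pi>: "\<pi> permutes {1..n}" "\<pi> 1 = i" "\<pi> 2 = j" by (auto simp: g_def)
    show "(X i - X j) ^ 2 dvd f"
    proof (rule square_dvd[OF ij(3)])
      show "subst (\<lambda>k. X (transpose i j k)) f = f"
        using f permutes_swap_id[OF ij(1,2)] by (simp add: sym_polys_def)
      let ?v = "\<lambda>k. (X(i := X j)) (\<pi> k)"
      have "subst (X(i := X j)) f = subst ?v f" by (rule subst_permuted[OF f \<pi>(1), symmetric])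
      also have "\<dots> = subst ?v (subst (collapse 2) f)" by (rule subst_collapse_2[symmetric]) (use \<pi>(2,3) in auto)
      finally show "subst (X(i := X j)) f = 0" using zero by simp
    qed
  qed auto
  then show "Disc {1..n} dvd f" by simp
qed

section \<open>Lifts lie in the pieces of the filtration\<close>

text \<open>The permuted head has at most three elements, so one of 1, 2, 3, 4 lies in the permuted
  tail. Identifying it with its partner in the pairs 1, 2 and 3, 4 kills the seed.\<close>

lemma sym_lift_ideal_I:
  assumes a: "a \<in> Sym {m<..n} (insert 1 {m<..n})" and m: "2 \<le> m" "m \<le> 3" and n: "4 \<le> n"
  shows "sym_lift n m a \<in> ideal_I n"
proof -
  have "subst pairs_collapsed (subst (\<lambda>i. X (\<pi> i)) (seed n m)) = 0" if \<pi>: "\<pi> permutes {1..n}" for \<pi>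
  proof -
    have "\<not> {1, 2, 3, 4} \<subseteq> \<pi> ` {1..m}"
    proof
      assume "{1, 2, 3, 4} \<subseteq> \<pi> ` {1..m}"
      then have "card {1, 2, 3, 4::nat} \<le> card (\<pi> ` {1..m})" by (intro card_mono) auto
      also have "\<dots> \<le> m" using card_image_le[of "{1..m}" \<pi>] by simp
      finally show False using m by simp
    qed
    then obtain i where i: "i \<in> {1, 2, 3, 4}" "i \<notin> \<pi> ` {1..m}" by blast
    have "{1..n} = {1..m} \<union> {m<..n}" using m n by auto
    then have "\<pi> ` {1..m} \<union> \<pi> ` {m<..n} = {1..n}" using permutes_image[OF \<pi>] by (metis image_Un)
    moreover have "i \<in> {1..n}" using i n by auto
    ultimately have "i \<in> \<pi> ` {m<..n}" using i by blast
    then show ?thesis using i m n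
      by (intro subst_seed_eq_0[OF \<pi>, of m i "if i = 1 then 2 else if i = 2 then 1 else if i = 3 then 4 else 3"])
        (auto simp: pairs_collapsed_def)
  qed
  then have "subst pairs_collapsed (sym_lift n m a) = 0" by (simp add: sym_lift_def)
  moreover have "sym_lift n m a \<in> sym_polys n" using sym_lift_sym_polys[OF Sym_Pol[OF a]] m n by simp
  ultimately show ?thesis by (simp add: ideal_I_def)
qed

text \<open>The permuted head cannot contain 1, 2 and 3, so one of them lies in the permuted tail
  and is identified with another.\<close>

lemma sym_lift_2_collapse_3:
  assumes n: "4 \<le> n"
  shows "subst (collapse 3) (sym_lift n 2 a) = 0"
proof -
  have "subst (collapse 3) (subst (\<lambda>i. X (\<pi> i)) (seed n 2)) = 0" if \<pi>: "\<pi> permutes {1..n}" for \<pi>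
  proof -
    have "\<not> {1, 2, 3} \<subseteq> \<pi> ` {1..2}"
    proof
      assume "{1, 2, 3} \<subseteq> \<pi> ` {1..2}"
      then have "card {1, 2, 3::nat} \<le> card (\<pi> ` {1..2})" by (intro card_mono) auto
      also have "\<dots> \<le> 2" using card_image_le[of "{1..2}" \<pi>] by simp
      finally show False by simp
    qed
    then obtain i where i: "i \<in> {1, 2, 3}" "i \<notin> \<pi> ` {1..2}" by blast
    have "{1..n} = {1..2} \<union> {2<..n}" using n by auto
    then have "\<pi> ` {1..2} \<union> \<pi> ` {2<..n} = {1..n}" using permutes_image[OF \<pi>] by (metis image_Un)
    moreover have "i \<in> {1..n}" using i n by auto
    ultimately have "i \<in> \<pi> ` {2<..n}" using i by blast
    then show ?thesis using i n
      by (intro subst_seed_eq_0[OF \<pi>, of 2 i "if i = 1 then 2 else 1"]) (auto simp: collapse_def)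
  qed
  then show ?thesis by (simp add: sym_lift_def)
qed

subsection \<open>The Hilbert series of the ideal\<close>

lemma subspace_kernel: "cpoly.subspace V \<Longrightarrow> cpoly.subspace {f \<in> V. subst s f = 0}"
  by (auto simp: cpoly.subspace_def scale_def)

lemma Disc_Sym: "Disc S \<in> Sym S S"
  using subst_Disc[OF permutes_inj_on] by (auto simp: Sym_def Disc_Pol permutes_image)

text \<open>Two applications of \<open>dim_stage\<close>, for \<open>m = 3\<close> and
  \<open>m = 2\<close>, peel off the first two summands. What remains is the image of multiplication
  by \<open>Disc {1..n}\<close>.\<close>

lemma dim_ideal_I_comp:
  assumes n: "4 \<le> n"
  shows "cpoly.dim (ideal_I_comp n d) =
    cpoly.dim {a \<in> Sym {3<..n} (insert 1 {3<..n}). homogeneous d (collapse_factor n 3 * a)} +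
    cpoly.dim {a \<in> Sym {2<..n} (insert 1 {2<..n}). homogeneous d (collapse_factor n 2 * a)} +
    cpoly.dim {a \<in> Sym {1..n} {1..n}. homogeneous d (Disc {1..n} * a)}"
proof -
  let ?V = "ideal_I_comp n d"
  let ?K = "{f \<in> ?V. subst (collapse 3) f = 0}"
  let ?J = "{f \<in> ?K. subst (collapse 2) f = 0}"
  let ?A = "{a \<in> Sym {1..n} {1..n}. homogeneous d (Disc {1..n} * a)}"
  have V_eq: "?V = {f \<in> {f \<in> Sym {1..n} {1..n}. homogeneous d f}. subst pairs_collapsed f = 0}"
    by (auto simp: ideal_I_comp_def ideal_I_def sym_polys_eq_Sym)
  have V: "cpoly.subspace ?V" unfolding V_eq by (intro subspace_kernel subspace_Sym)
  have Vsub: "?V \<subseteq> {f \<in> sym_polys n. homogeneous d f}" by (auto simp: ideal_I_comp_def ideal_I_def)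
  have "cpoly.dim ?V = cpoly.dim {a \<in> Sym {3<..n} (insert 1 {3<..n}). homogeneous d (collapse_factor n 3 * a)} + cpoly.dim ?K"
  proof (rule dim_stage[OF _ _ V Vsub])
    fix f assume "f \<in> ?V"
    then show "collapse_factor n 3 dvd subst (collapse 3) f" by (intro ideal_I_collapse_3[OF _ n]) (simp add: ideal_I_comp_def)
  next
    fix a assume "a \<in> Sym {3<..n} (insert 1 {3<..n})" "homogeneous d (sym_lift n 3 a)"
    then show "sym_lift n 3 a \<in> ?V" using sym_lift_ideal_I[of a 3 n] n by (simp add: ideal_I_comp_def)
  qed (use n in auto)
  moreover have "cpoly.dim ?K = cpoly.dim {a \<in> Sym {2<..n} (insert 1 {2<..n}). homogeneous d (collapse_factor n 2 * a)} + cpoly.dim ?J"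
  proof (rule dim_stage[OF _ _ subspace_kernel[OF V]])
    fix f assume "f \<in> ?K"
    then show "collapse_factor n 2 dvd subst (collapse 2) f" by (intro ideal_I_collapse_2[OF _ n]) (auto simp: ideal_I_comp_def)
  next
    fix a assume "a \<in> Sym {2<..n} (insert 1 {2<..n})" "homogeneous d (sym_lift n 2 a)"
    then show "sym_lift n 2 a \<in> ?K" using sym_lift_ideal_I[of a 2 n] sym_lift_2_collapse_3[OF n, of a] n by (simp add: ideal_I_comp_def)
  qed (use n Vsub in auto)
  moreover have "cpoly.dim ?J = cpoly.dim ?A"
  proof -
    have J: "?J = {f \<in> sym_polys n. homogeneous d f \<and> subst (collapse 2) f = 0}"
    proof -
      \<comment> \<open>Both substitutions identify the variables 1 and 2, so they factor through
        \<open>collapse 2\<close>.\<close>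
      have "subst (collapse 3) f = 0 \<and> subst pairs_collapsed f = 0" if "subst (collapse 2) f = 0" for f
      proof -
        have "subst (collapse 3) f = subst (collapse 3) (subst (collapse 2) f)"
          unfolding subst_subst by (intro arg_cong[of _ _ "\<lambda>s. subst s f"] ext) (auto simp: collapse_def)
        moreover have "subst pairs_collapsed f = subst pairs_collapsed (subst (collapse 2) f)"
          unfolding subst_subst by (intro arg_cong[of _ _ "\<lambda>s. subst s f"] ext) (auto simp: collapse_def pairs_collapsed_def)
        ultimately show ?thesis using that by simp
      qed
      then show ?thesis by (auto simp: ideal_I_comp_def ideal_I_def)
    qed
    have D0: "Disc {1..n} \<noteq> 0" by simp
    have "?J = (*) (Disc {1..n}) ` ?A"
    proof (intro equalityI subsetI)
      fix f assume "f \<in> ?J"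
      then have f: "f \<in> sym_polys n" "homogeneous d f" "subst (collapse 2) f = 0" unfolding J by auto
      have "Disc {1..n} dvd f" using collapse_2_eq_0_iff[OF f(1)] f(3) n by simp
      then obtain a where a: "f = Disc {1..n} * a" ..
      then have "a \<in> Sym {1..n} {1..n}"
        using f(1) Sym_quotient[OF _ Disc_Sym D0] by (simp add: sym_polys_eq_Sym)
      then show "f \<in> (*) (Disc {1..n}) ` ?A" using a f(2) by auto
    next
      fix f assume "f \<in> (*) (Disc {1..n}) ` ?A"
      then obtain a where a: "f = Disc {1..n} * a" "a \<in> ?A" by blast
      then have "f \<in> sym_polys n" using Sym_mult[OF Disc_Sym] by (simp add: sym_polys_eq_Sym)
      then show "f \<in> ?J" unfolding J using collapse_2_eq_0_iff[of f n] a n by simp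
    qed
    moreover obtain U where "finite U" "?A \<subseteq> cpoly.span U"
      using shift_finite_span[OF homogeneous_Disc D0, of "{1..n}"] by blast
    ultimately show ?thesis
      using dim_inj_image[OF linear_mult inj_mult[OF D0] shift_subspace, of U "{1..n}" "{1..n}" d "Disc {1..n}"] by simp
  qed
  ultimately show ?thesis by simp
qed

lemma divide_eq_mult_fps:
  fixes F G Q :: "rat fps"
  assumes "G * Q = 1"
  shows "F / Q = F * G"
proof -
  have "Q \<noteq> 0" using assms by auto
  then show ?thesis by (metis assms mult.assoc mult.right_neutral nonzero_mult_div_cancel_right)
qed

theorem theorem7p1:
  fixes n :: nat
  assumes "n \<ge> 4"
  shows "ch_I n =
      fps_X ^ ((n - 1) * (n - 3)) / (qfac 1 * qfac (n - 3))
    + fps_X ^ ((n - 2) * (n - 1)) / (qfac 1 * qfac (n - 2))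
    + fps_X ^ (n * (n - 1)) / qfac n"
proof -
  let ?S = "\<lambda>m. Abs_fps (\<lambda>d. of_nat (cpoly.dim {a \<in> Sym {m<..n} (insert 1 {m<..n}). homogeneous d a})) :: rat fps"
  let ?T = "Abs_fps (\<lambda>d. of_nat (cpoly.dim {a \<in> Sym {1..n} {1..n}. homogeneous d a})) :: rat fps"
  \<comment> \<open>With \<open>n = k + 4\<close> the truncated subtractions in the exponents become
    polynomial identities in \<open>k\<close>.\<close>
  obtain k where k: "n = k + 4" using assms by (metis add.commute le_Suc_ex)
  have e3: "(n - 3) * (n - 3 - 1) + 3 * (n - 3) = (n - 1) * (n - 3)" by (simp add: k algebra_simps)
  have e2: "(n - 2) * (n - 2 - 1) + 2 * (n - 2) = (n - 2) * (n - 1)" by (simp add: k algebra_simps)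
  have e0: "homogeneous (n * (n - 1)) (Disc {1..n})" using homogeneous_Disc[of "{1..n}"] by simp
  have "ch_I n =
    Abs_fps (\<lambda>d. of_nat (cpoly.dim {a \<in> Sym {3<..n} (insert 1 {3<..n}). homogeneous d (collapse_factor n 3 * a)})) +
    Abs_fps (\<lambda>d. of_nat (cpoly.dim {a \<in> Sym {2<..n} (insert 1 {2<..n}). homogeneous d (collapse_factor n 2 * a)})) +
    Abs_fps (\<lambda>d. of_nat (cpoly.dim {a \<in> Sym {1..n} {1..n}. homogeneous d (Disc {1..n} * a)}))"
    by (rule fps_ext) (simp add: ch_I_def dim_ideal_I_comp[OF assms])
  also have "\<dots> = fps_X ^ ((n - 1) * (n - 3)) * ?S 3 + fps_X ^ ((n - 2) * (n - 1)) * ?S 2 + fps_X ^ (n * (n - 1)) * ?T"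
    using shift_fps[OF homogeneous_collapse_factor[of n 3] collapse_factor_nonzero] shift_fps[OF homogeneous_collapse_factor[of n 2] collapse_factor_nonzero]
      shift_fps[OF e0] unfolding e2 e3 by simp
  also have "fps_X ^ ((n - 1) * (n - 3)) * ?S 3 = fps_X ^ ((n - 1) * (n - 3)) / (qfac 1 * qfac (n - 3))"
    using Sym_insert_fps[of "{3<..n}" 1] by (intro divide_eq_mult_fps[symmetric]) simp
  also have "fps_X ^ ((n - 2) * (n - 1)) * ?S 2 = fps_X ^ ((n - 2) * (n - 1)) / (qfac 1 * qfac (n - 2))"
    using Sym_insert_fps[of "{2<..n}" 1] by (intro divide_eq_mult_fps[symmetric]) simp
  also have "fps_X ^ (n * (n - 1)) * ?T = fps_X ^ (n * (n - 1)) / qfac n"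
    using Sym_fps[of "{1..n}"] by (intro divide_eq_mult_fps[symmetric]) simp
  finally show ?thesis .
qed

end
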